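(* Let $f_j\in L^2_P(\Omega;L^2(0,T;H^{-1}(D)))$ for $j=1,\dots,J$, and suppose that the following two conditions hold. (iii) There is a constant $\theta>0$ such that for every $t\in[0,T]$, $P\{\omega\in\Omega:\min_{\mathbf x\in\overline D}a(\omega,\mathbf x,t)>\theta\}=1$. (iv) There are constants $\theta_->0$ and $\theta_+>0$ such that for every $t\in[0,T]$ and every $j=1,\dots,J$, with probability one $\theta_-\le|a(\omega_j,\cdot,t)-\overline a(\cdot,t)|_\infty\le\theta_+$. Then the finite element solution $u_{j,h}^n$ of the fully discrete ensemble scheme described in the context is stable provided $\theta>\theta_+$. In particular, in that case, for any $\Delta t>0$ and every $j=1,\dots,J$, $$E\big[\|u_{j,h}^N\|^2\big]+\theta_-\Delta t\,E\big[\|\nabla u_{j,h}^{N}\|^2\big]+(\theta-\theta_+)\Delta t\sum_{n=1}^{N}E\big[\|\nabla u_{j,h}^{n}\|^2\big]\le C\Delta t\sum_{n=1}^{N}E\big[\|f_j^{n}\|_{-1}^2\big]+C\Delta t\,E\big[\|\nabla u_{j,h}^0\|^2\big]+E\big[\|u_{j,h}^0\|^2\big],$$ where $C>0$ is a constant independent of $J$, $h$ and $\Delta t$.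
   Context: $(\Omega,\mathcal F,P)$ is a complete probability space, $D\subset\mathbb R^d$ ($d=1,2,3$) a bounded Lipschitz domain, $T>0$, $l\ge1$ and $J\ge1$ integers. $\|\cdot\|$ and $(\cdot,\cdot)$ are the $L^2(D)$ norm and inner product (also used for the duality pairing of $H^{-1}(D)$ and $H_0^1(D)$), $|v|_\infty=\operatorname{ess\,sup}_{\mathbf x\in D}|v(\mathbf x)|$, and $\|f\|_{-1}=\sup_{0\ne v\in H_0^1(D)}(f,v)/\|\nabla v\|$. Consider the random parabolic problem, almost surely: $u_t-\nabla\cdot[a(\omega,\mathbf x,t)\nabla u]=f(\omega,\mathbf x,t)$ in $D\times(0,T)$, $u=0$ on $\partial D\times(0,T)$, $u(\omega,\cdot,0)=u^0(\omega,\cdot)$ in $D$, where $a,f,u^0$ are random fields with continuous and bounded covariance functions. Let $\omega_1,\dots,\omega_J$ be independent samples drawn from $(\Omega,\mathcal F,P)$, and put $a_j=a(\omega_j,\cdot,\cdot)$, $f_j=f(\omega_j,\cdot,\cdot)$, $u_j^0=u^0(\omega_j,\cdot)$ and $\overline a(\mathbf x,t)=\frac1J\sum_{j=1}^Ja(\omega_j,\mathbf x,t)$. $E$ denotes expectation with respect to the samples. $\mathcal T_h$ is a quasi-uniform triangulation of $D$ with mesh size $h=\max_{K\in\mathcal T_h}\operatorname{diam}K$, $\overline D=\bigcup_{K\in\mathcal T_h}\overline K$, and $V_h=\{v\in H_0^1(D): v|_K\text{ is a polynomial of degree at most } l\text{ for all }K\in\mathcal T_h\}$. Let $\Delta t=T/N$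 with $N\ge1$ an integer, $t_n=n\Delta t$; a superscript $n$ on $a_j,\overline a,f_j$ denotes evaluation at $t=t_n$ (the data are assumed to be such that these evaluations make sense, with $a_j^n\in L^\infty(D)$, $f_j^n\in H^{-1}(D)$). Fully discrete ensemble scheme: $u_{j,h}^0\in V_h$ satisfies $(u_{j,h}^0,v_h)=(u_j^0,v_h)$ for all $v_h\in V_h$, and for $n=0,\dots,N-1$ and $j=1,\dots,J$, $u_{j,h}^{n+1}\in V_h$ satisfies $$\Big(\frac{u_{j,h}^{n+1}-u_{j,h}^n}{\Delta t},v_h\Big)+(\overline a^{n+1}\nabla u_{j,h}^{n+1},\nabla v_h)+((a_j^{n+1}-\overline a^{n+1})\nabla u_{j,h}^n,\nabla v_h)=(f_j^{n+1},v_h)\quad\forall v_h\in V_h.$$ The constant $C$ is generic; it may depend on $\theta,\theta_-,\theta_+$. "Stable" means that the displayed bound by the data holds. *)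

theory Defs
  imports "HOL-Probability.Probability"
begin

section \<open>The spaces \<open>L\<^sup>2(D)\<close>, \<open>L\<^sup>\<infinity>(D)\<close>, \<open>H\<^sup>1\<^sub>0(D)\<close> and \<open>H\<^sup>-\<^sup>1(D)\<close>\<close>

text \<open>Near each boundary point, in a suitable direction \<open>e\<close>, the set \<open>D\<close> lies strictly above
  the graph of a Lipschitz function; that the function only depends on the coordinates orthogonal
  to \<open>e\<close> is expressed by its invariance under translation along \<open>e\<close>.\<close>

definition bounded_lipschitz_domain :: "(real^'d) set \<Rightarrow> bool" where
  "bounded_lipschitz_domain D \<longleftrightarrow>
     D \<noteq> {} \<and> open D \<and> connected D \<and> bounded D \<and>
     (\<forall>p\<in>frontier D. \<exists>r>0. \<exists>e g L. norm e = 1 \<and> L-lipschitz_on UNIV g \<and>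
        (\<forall>x s. g (x + s *\<^sub>R e) = g x) \<and>
        D \<inter> ball p r = {x \<in> ball p r. g x < x \<bullet> e})"

text \<open>Functions on \<open>D\<close> are total functions whose values outside \<open>D\<close> are ignored, and they
  represent their classes modulo null sets. The codomain is \<open>real\<close> or, for gradients,
  \<open>real^'d\<close>.\<close>

definition L2 :: "(real^'d) set \<Rightarrow> ((real^'d) \<Rightarrow> 'b::euclidean_space) set" where
  "L2 D = {v \<in> borel_measurable (lebesgue_on D). integrable (lebesgue_on D) (\<lambda>x. (norm (v x))\<^sup>2)}"

definition L2_inner :: "(real^'d) set \<Rightarrow> ((real^'d) \<Rightarrow> 'b::euclidean_space) \<Rightarrow> ((real^'d) \<Rightarrow> 'b) \<Rightarrow> real" where
  "L2_inner D v w = (LINT x|lebesgue_on D. v x \<bullet> w x)"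

definition L2_norm :: "(real^'d) set \<Rightarrow> ((real^'d) \<Rightarrow> 'b::euclidean_space) \<Rightarrow> real" where
  "L2_norm D v = sqrt (L2_inner D v v)"

definition Linf_norm :: "(real^'d) set \<Rightarrow> ((real^'d) \<Rightarrow> real) \<Rightarrow> ereal" where
  "Linf_norm D v = esssup (lebesgue_on D) (\<lambda>x. ereal \<bar>v x\<bar>)"

definition Linf :: "(real^'d) set \<Rightarrow> ((real^'d) \<Rightarrow> real) set" where
  "Linf D = {v \<in> borel_measurable (lebesgue_on D). Linf_norm D v < \<infinity>}"

primrec Ck :: "nat \<Rightarrow> ((real^'d) \<Rightarrow> real) \<Rightarrow> bool" where
  "Ck 0 f \<longleftrightarrow> continuous_on UNIV f"
| "Ck (Suc k) f \<longleftrightarrow>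
     (\<exists>g :: 'd \<Rightarrow> (real^'d) \<Rightarrow> real.
        (\<forall>x. (f has_derivative (\<lambda>y. \<Sum>i\<in>UNIV. g i x * y $ i)) (at x)) \<and> (\<forall>i. Ck k (g i)))"

definition test_functions :: "(real^'d) set \<Rightarrow> ((real^'d) \<Rightarrow> real) set" where
  "test_functions D =
     {\<phi>. (\<forall>k. Ck k \<phi>) \<and> compact (closure {x. \<phi> x \<noteq> 0}) \<and> closure {x. \<phi> x \<noteq> 0} \<subseteq> D}"

definition classical_grad :: "((real^'d) \<Rightarrow> real) \<Rightarrow> (real^'d) \<Rightarrow> real^'d" where
  "classical_grad \<phi> x = (\<chi> i. frechet_derivative \<phi> (at x) (axis i 1))"

text \<open>\<open>H\<^sup>1\<^sub>0(D)\<close> is the closure of the test functions in the \<open>H\<^sup>1\<close> norm: \<open>v\<close> belongs to it, with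
  gradient \<open>G\<close>, iff some test functions converge to \<open>v\<close> in \<open>L\<^sup>2\<close> while their gradients converge
  to \<open>G\<close> in \<open>L\<^sup>2\<close>. The gradient is determined almost everywhere.\<close>

definition has_H10_grad :: "(real^'d) set \<Rightarrow> ((real^'d) \<Rightarrow> real) \<Rightarrow> ((real^'d) \<Rightarrow> real^'d) \<Rightarrow> bool" where
  "has_H10_grad D v G \<longleftrightarrow> v \<in> L2 D \<and> G \<in> L2 D \<and>
     (\<exists>\<phi> :: nat \<Rightarrow> (real^'d) \<Rightarrow> real. (\<forall>k. \<phi> k \<in> test_functions D) \<and>
        (\<lambda>k. L2_norm D (\<lambda>x. \<phi> k x - v x)) \<longlonglongrightarrow> 0 \<and>
        (\<lambda>k. L2_norm D (\<lambda>x. classical_grad (\<phi> k) x - G x)) \<longlonglongrightarrow> 0)"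

definition H10 :: "(real^'d) set \<Rightarrow> ((real^'d) \<Rightarrow> real) set" where
  "H10 D = {v. \<exists>G. has_H10_grad D v G}"

definition grad :: "(real^'d) set \<Rightarrow> ((real^'d) \<Rightarrow> real) \<Rightarrow> (real^'d) \<Rightarrow> real^'d" where
  "grad D v = (SOME G. has_H10_grad D v G)"

text \<open>An element \<open>F\<close> of \<open>H\<^sup>-\<^sup>1(D)\<close> is a bounded linear functional on \<open>H\<^sup>1\<^sub>0(D)\<close>, and the duality
  pairing \<open>(F, v)\<close> is \<open>F v\<close>. Boundedness makes \<open>F\<close> compatible with almost everywhere equality;
  the values of \<open>F\<close> outside \<open>H\<^sup>1\<^sub>0(D)\<close> are irrelevant.\<close>

type_synonym 'd dual = "((real^'d) \<Rightarrow> real) \<Rightarrow> real"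

definition Hm1 :: "(real^'d) set \<Rightarrow> 'd dual set" where
  "Hm1 D = {F. (\<forall>v\<in>H10 D. \<forall>w\<in>H10 D. F (\<lambda>x. v x + w x) = F v + F w) \<and>
               (\<forall>c. \<forall>v\<in>H10 D. F (\<lambda>x. c * v x) = c * F v) \<and>
               (\<exists>K. \<forall>v\<in>H10 D. \<bar>F v\<bar> \<le> K * L2_norm D (grad D v))}"

definition Hm1_norm :: "(real^'d) set \<Rightarrow> 'd dual \<Rightarrow> real" where
  "Hm1_norm D F = (SUP v\<in>{v \<in> H10 D. L2_norm D v \<noteq> 0}. F v / L2_norm D (grad D v))"

section \<open>Bochner spaces\<close>

text \<open>\<open>X\<close> with the seminorm \<open>N\<close> plays the role of a Banach space, whose elements are
  represented by functions; subtraction is pointwise.\<close>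

definition strongly_measurable ::
  "'a measure \<Rightarrow> 'x::minus set \<Rightarrow> ('x \<Rightarrow> real) \<Rightarrow> ('a \<Rightarrow> 'x) \<Rightarrow> bool" where
  "strongly_measurable \<mu> X N f \<longleftrightarrow> (AE z in \<mu>. f z \<in> X) \<and>
     (\<exists>s :: nat \<Rightarrow> 'a \<Rightarrow> 'x. (\<forall>k. simple_function \<mu> (s k) \<and> s k ` space \<mu> \<subseteq> X) \<and>
        (AE z in \<mu>. (\<lambda>k. N (s k z - f z)) \<longlonglongrightarrow> 0))"

definition bochner_L2 ::
  "'a measure \<Rightarrow> 'x::minus set \<Rightarrow> ('x \<Rightarrow> real) \<Rightarrow> ('a \<Rightarrow> 'x) set" where
  "bochner_L2 \<mu> X N = {f. strongly_measurable \<mu> X N f \<and> integrable \<mu> (\<lambda>z. (N (f z))\<^sup>2)}"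

definition bochner_L2_norm :: "'a measure \<Rightarrow> ('x \<Rightarrow> real) \<Rightarrow> ('a \<Rightarrow> 'x) \<Rightarrow> real" where
  "bochner_L2_norm \<mu> N f = sqrt (LINT z|\<mu>. (N (f z))\<^sup>2)"

definition L2_time_Hm1 :: "real \<Rightarrow> (real^'d) set \<Rightarrow> (real \<Rightarrow> 'd dual) set" where
  "L2_time_Hm1 T D = bochner_L2 (lebesgue_on {0<..<T}) (Hm1 D) (Hm1_norm D)"

definition L2_time_Hm1_norm :: "real \<Rightarrow> (real^'d) set \<Rightarrow> (real \<Rightarrow> 'd dual) \<Rightarrow> real" where
  "L2_time_Hm1_norm T D = bochner_L2_norm (lebesgue_on {0<..<T}) (Hm1_norm D)"

section \<open>Random data and samples\<close>

definition covariance :: "'w measure \<Rightarrow> ('w \<Rightarrow> real) \<Rightarrow> ('w \<Rightarrow> real) \<Rightarrow> real" where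
  "covariance M X Y = (LINT \<omega>|M. (X \<omega> - (LINT \<omega>'|M. X \<omega>')) * (Y \<omega> - (LINT \<omega>'|M. Y \<omega>')))"

definition random_field :: "'w measure \<Rightarrow> 'i::metric_space set \<Rightarrow> ('w \<Rightarrow> 'i \<Rightarrow> real) \<Rightarrow> bool" where
  "random_field M I X \<longleftrightarrow>
     (\<forall>p\<in>I. (\<lambda>\<omega>. X \<omega> p) \<in> borel_measurable M \<and> integrable M (\<lambda>\<omega>. (X \<omega> p)\<^sup>2)) \<and>
     continuous_on (I \<times> I) (\<lambda>(p, q). covariance M (\<lambda>\<omega>. X \<omega> p) (\<lambda>\<omega>. X \<omega> q)) \<and>
     bounded ((\<lambda>(p, q). covariance M (\<lambda>\<omega>. X \<omega> p) (\<lambda>\<omega>. X \<omega> q)) ` (I \<times> I))"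

text \<open>The right-hand side takes values in \<open>H\<^sup>-\<^sup>1(D)\<close>, so it need not have point values in space and
  is a generalized random field: its covariance is the bilinear form
  \<open>(v, w) \<mapsto> Cov((f(t), v), (f(s), w))\<close> on \<open>H\<^sup>1\<^sub>0(D)\<close>. If \<open>f\<close> is a function of \<open>(\<omega>, x, t)\<close> with
  continuous bounded covariance function \<open>c\<close>, this form is
  \<open>\<integral>\<integral> c(x, t, y, s) v(x) w(y) dx dy\<close>, which is continuous in \<open>(t, s)\<close> and, by the Poincare
  inequality, bounded as below.\<close>

definition Hm1_random_field ::
  "'w measure \<Rightarrow> (real^'d) set \<Rightarrow> real \<Rightarrow> ('w \<Rightarrow> real \<Rightarrow> 'd dual) \<Rightarrow> bool" where
  "Hm1_random_field M D T f \<longleftrightarrow>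
     (\<forall>t\<in>{0..T}. strongly_measurable M (Hm1 D) (Hm1_norm D) (\<lambda>\<omega>. f \<omega> t)) \<and>
     (\<forall>t\<in>{0..T}. \<forall>v\<in>H10 D. integrable M (\<lambda>\<omega>. (f \<omega> t v)\<^sup>2)) \<and>
     (\<forall>v\<in>H10 D. \<forall>w\<in>H10 D. continuous_on ({0..T} \<times> {0..T})
        (\<lambda>(t, s). covariance M (\<lambda>\<omega>. f \<omega> t v) (\<lambda>\<omega>. f \<omega> s w))) \<and>
     (\<exists>K. \<forall>t\<in>{0..T}. \<forall>s\<in>{0..T}. \<forall>v\<in>H10 D. \<forall>w\<in>H10 D.
        \<bar>covariance M (\<lambda>\<omega>. f \<omega> t v) (\<lambda>\<omega>. f \<omega> s w)\<bar> \<le> K * L2_norm D (grad D v) * L2_norm D (grad D w))"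

text \<open>\<open>M\<close> is \<open>(\<Omega>, F, P)\<close>; the samples \<open>\<omega>\<^sub>1, \<dots>, \<omega>\<^sub>J\<close> are independent random elements \<open>W 1, \<dots>, W J\<close>
  of \<open>\<Omega>\<close> with law \<open>P\<close>, defined on a probability space \<open>S\<close>. Expectation with respect to the samples
  is expectation over \<open>S\<close>.\<close>

definition independent_samples :: "'w measure \<Rightarrow> 's measure \<Rightarrow> nat \<Rightarrow> (nat \<Rightarrow> 's \<Rightarrow> 'w) \<Rightarrow> bool" where
  "independent_samples M S J W \<longleftrightarrow> prob_space S \<and>
     prob_space.indep_vars S (\<lambda>_. M) W {1..J} \<and> (\<forall>j\<in>{1..J}. distr S M (W j) = M)"

text \<open>Expectation of a nonnegative quantity, with value \<open>\<infinity>\<close> when it is not integrable; the Bochner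
  integral would return \<open>0\<close> in that case.\<close>

abbreviation nn_expectation :: "'s measure \<Rightarrow> ('s \<Rightarrow> real) \<Rightarrow> ennreal" where
  "nn_expectation S X \<equiv> (\<integral>\<^sup>+ s. ennreal (X s) \<partial>S)"

section \<open>Finite elements and the ensemble scheme\<close>

definition mesh_size :: "(real^'d) set set \<Rightarrow> real" where
  "mesh_size \<T> = Max (diameter ` \<T>)"

text \<open>The elements are closed simplices. The parameter \<open>\<sigma>\<close> is the constant of the quasi-uniform
  family to which the mesh belongs.\<close>

definition quasi_uniform_mesh :: "real \<Rightarrow> (real^'d) set \<Rightarrow> (real^'d) set set \<Rightarrow> bool" where
  "quasi_uniform_mesh \<sigma> D \<T> \<longleftrightarrow>
     triangulation \<T> \<and> (\<forall>K\<in>\<T>. int CARD('d) simplex K) \<and> \<Union>\<T> = closure D \<and>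
     0 < \<sigma> \<and> (\<forall>K\<in>\<T>. \<exists>c. cball c (\<sigma> * mesh_size \<T>) \<subseteq> K)"

definition polynomials_upto :: "nat \<Rightarrow> ((real^'d) \<Rightarrow> real) set" where
  "polynomials_upto l =
     {p. \<exists>c :: ('d \<Rightarrow> nat) \<Rightarrow> real.
        p = (\<lambda>x. \<Sum>\<alpha>\<in>{\<alpha>. (\<Sum>i\<in>UNIV. \<alpha> i) \<le> l}. c \<alpha> * (\<Prod>i\<in>UNIV. x $ i ^ \<alpha> i))}"

definition fe_space :: "(real^'d) set \<Rightarrow> (real^'d) set set \<Rightarrow> nat \<Rightarrow> ((real^'d) \<Rightarrow> real) set" where
  "fe_space D \<T> l =
     {v \<in> H10 D. \<forall>K\<in>\<T>. \<exists>p\<in>polynomials_upto l. AE x in lebesgue_on K. v x = p x}"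

definition ensemble_mean :: "nat \<Rightarrow> (nat \<Rightarrow> 'x \<Rightarrow> real) \<Rightarrow> 'x \<Rightarrow> real" where
  "ensemble_mean J a x = (\<Sum>j=1..J. a j x) / real J"

text \<open>The scheme for one realization of the samples: \<open>a j n\<close>, \<open>F j n\<close>, \<open>g j\<close> and \<open>u j n\<close> stand for
  \<open>a\<^sub>j\<^sup>n\<close>, \<open>f\<^sub>j\<^sup>n\<close>, \<open>u\<^sub>j\<^sup>0\<close> and \<open>u\<^sub>j\<^sub>,\<^sub>h\<^sup>n\<close>.\<close>

definition ensemble_scheme ::
  "(real^'d) set \<Rightarrow> ((real^'d) \<Rightarrow> real) set \<Rightarrow> nat \<Rightarrow> nat \<Rightarrow> real \<Rightarrow>
   (nat \<Rightarrow> nat \<Rightarrow> (real^'d) \<Rightarrow> real) \<Rightarrow> (nat \<Rightarrow> nat \<Rightarrow> 'd dual) \<Rightarrow> (nat \<Rightarrow> (real^'d) \<Rightarrow> real) \<Rightarrow>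
   (nat \<Rightarrow> nat \<Rightarrow> (real^'d) \<Rightarrow> real) \<Rightarrow> bool" where
  "ensemble_scheme D V J N \<Delta>t a F g u \<longleftrightarrow>
     (\<forall>j\<in>{1..J}. u j 0 \<in> V \<and> (\<forall>v\<in>V. L2_inner D (u j 0) v = L2_inner D (g j) v)) \<and>
     (\<forall>n<N. \<forall>j\<in>{1..J}. u j (Suc n) \<in> V \<and>
        (\<forall>v\<in>V.
           L2_inner D (\<lambda>x. (u j (Suc n) x - u j n x) / \<Delta>t) v
           + L2_inner D (\<lambda>x. ensemble_mean J (\<lambda>i. a i (Suc n)) x *\<^sub>R grad D (u j (Suc n)) x) (grad D v)
           + L2_inner D (\<lambda>x. (a j (Suc n) x - ensemble_mean J (\<lambda>i. a i (Suc n)) x) *\<^sub>R grad D (u j n) x) (grad D v)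
           = F j (Suc n) v))"

end

theory Submission
  imports Defs
begin

text \<open>Testing the scheme with \<open>v = u\<^sub>j\<^sup>n\<^sup>+\<^sup>1\<close> gives, for almost every sample, the energy inequality
  \<open>\<parallel>u\<^sup>n\<^sup>+\<^sup>1\<parallel>\<^sup>2 + \<theta> \<Delta>t \<parallel>\<nabla>u\<^sup>n\<^sup>+\<^sup>1\<parallel>\<^sup>2 \<le> \<parallel>u\<^sup>n\<parallel>\<^sup>2 + \<theta>\<^sub>+ \<Delta>t \<parallel>\<nabla>u\<^sup>n\<parallel>\<^sup>2 + \<Delta>t \<parallel>f\<^sup>n\<^sup>+\<^sup>1\<parallel>\<^sub>-\<^sub>1\<^sup>2 / (\<theta> - \<theta>\<^sub>+)\<close>,
  which telescopes, so \<open>C = max \<theta>\<^sub>+ (1 / (\<theta> - \<theta>\<^sub>+))\<close> works; here \<open>\<theta>\<^sub>- \<le> \<theta>\<^sub>+\<close>.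

  The solution is not assumed to be a measurable function of the sample, so the expectations are
  lower integrals. These are superadditive, which suffices on the left. On the right, all summands
  but \<open>\<parallel>\<nabla>u\<^sup>0\<parallel>\<^sup>2\<close> are measurable: \<open>\<parallel>f\<^sup>n\<parallel>\<^sub>-\<^sub>1\<close> because \<open>f\<^sup>n\<close> is strongly measurable and \<open>\<parallel>\<cdot>\<parallel>\<^sub>-\<^sub>1\<close> is a
  seminorm (its symmetry needs uniqueness of weak gradients), and \<open>\<parallel>u\<^sup>0\<parallel>\<^sup>2\<close> because it is the
  supremum of \<open>2 (u\<^sub>0, v) - \<parallel>v\<parallel>\<^sup>2\<close> over a countable dense set of finite element functions \<open>v\<close>.\<close>

section \<open>The inner product of \<open>L\<^sup>2(D)\<close>\<close>

lemma L2_borel: "v \<in> L2 D \<Longrightarrow> v \<in> borel_measurable (lebesgue_on D)"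
  by (simp add: L2_def)

lemma L2_integrable_norm2: "v \<in> L2 D \<Longrightarrow> integrable (lebesgue_on D) (\<lambda>x. (norm (v x))\<^sup>2)"
  by (simp add: L2_def)

lemma two_inner_le: "2 * \<bar>x \<bullet> y\<bar> \<le> (norm x)\<^sup>2 + (norm (y::'a::real_inner))\<^sup>2"
proof -
  have "0 \<le> (norm x - norm y)\<^sup>2" by simp
  then have "2 * (norm x * norm y) \<le> (norm x)\<^sup>2 + (norm y)\<^sup>2"
    by (simp add: power2_diff)
  with Cauchy_Schwarz_ineq2[of x y] show ?thesis by linarith
qed

lemma L2_integrable_inner:
  assumes "v \<in> L2 D" "w \<in> L2 D"
  shows "integrable (lebesgue_on D) (\<lambda>x. v x \<bullet> w x)"
proof (rule Bochner_Integration.integrable_bound)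
  show "integrable (lebesgue_on D) (\<lambda>x. (norm (v x))\<^sup>2 + (norm (w x))\<^sup>2)"
    using assms by (intro Bochner_Integration.integrable_add L2_integrable_norm2)
  show "(\<lambda>x. v x \<bullet> w x) \<in> borel_measurable (lebesgue_on D)"
    using assms[THEN L2_borel] by measurable
  have "\<bar>v x \<bullet> w x\<bar> \<le> (norm (v x))\<^sup>2 + (norm (w x))\<^sup>2" for x
    using two_inner_le[of "v x" "w x"] by simp
  then show "AE x in lebesgue_on D. norm (v x \<bullet> w x) \<le> norm ((norm (v x))\<^sup>2 + (norm (w x))\<^sup>2)"
    by simp
qed

lemma L2_norm_power2: "(L2_norm D v)\<^sup>2 = (LINT x|lebesgue_on D. (norm (v x))\<^sup>2)"
  by (simp add: L2_norm_def L2_inner_def power2_norm_eq_inner)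

lemma L2_norm_nonneg [simp]: "0 \<le> L2_norm D v"
  by (simp add: L2_norm_def L2_inner_def)

lemma L2_inner_self: "L2_inner D v v = (L2_norm D v)\<^sup>2"
  by (simp add: L2_norm_def L2_inner_def)

text \<open>Keeps coefficient times gradient square integrable, so that the diffusion terms of the
  scheme are genuine integrals and not the default value \<open>0\<close>.\<close>

lemma L2_scaleR_bounded:
  fixes v :: "(real^'d) \<Rightarrow> 'b::euclidean_space"
  assumes v: "v \<in> L2 D" and b: "b \<in> borel_measurable (lebesgue_on D)"
    and K: "AE x in lebesgue_on D. \<bar>b x\<bar> \<le> K"
  shows "(\<lambda>x. b x *\<^sub>R v x) \<in> L2 D"
proof -
  have m: "(\<lambda>x. b x *\<^sub>R v x) \<in> borel_measurable (lebesgue_on D)"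
    using b L2_borel[OF v] by measurable
  have "integrable (lebesgue_on D) (\<lambda>x. (norm (b x *\<^sub>R v x))\<^sup>2)"
  proof (rule Bochner_Integration.integrable_bound)
    show "integrable (lebesgue_on D) (\<lambda>x. K\<^sup>2 * (norm (v x))\<^sup>2)"
      using L2_integrable_norm2[OF v] by simp
    show "(\<lambda>x. (norm (b x *\<^sub>R v x))\<^sup>2) \<in> borel_measurable (lebesgue_on D)"
      using m by measurable
    show "AE x in lebesgue_on D. norm ((norm (b x *\<^sub>R v x))\<^sup>2) \<le> norm (K\<^sup>2 * (norm (v x))\<^sup>2)"
      using K
    proof eventually_elim
      case (elim x)
      then have "\<bar>b x\<bar>\<^sup>2 \<le> K\<^sup>2" by (intro power_mono) auto
      then show ?case by (simp add: power_mult_distrib mult_right_mono)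
    qed
  qed
  with m show ?thesis by (simp add: L2_def)
qed

lemma L2_cmult: "v \<in> L2 D \<Longrightarrow> (\<lambda>x. c *\<^sub>R v x) \<in> L2 D"
  by (rule L2_scaleR_bounded[where K = "\<bar>c\<bar>"]) auto

lemma L2_add:
  assumes "v \<in> L2 D" "w \<in> L2 D"
  shows "(\<lambda>x. v x + w x) \<in> L2 D"
proof -
  have "integrable (lebesgue_on D) (\<lambda>x. (norm (v x + w x))\<^sup>2)"
  proof (rule Bochner_Integration.integrable_bound)
    show "integrable (lebesgue_on D) (\<lambda>x. 2 * (norm (v x))\<^sup>2 + 2 * (norm (w x))\<^sup>2)"
      using assms[THEN L2_integrable_norm2] by simp
    show "(\<lambda>x. (norm (v x + w x))\<^sup>2) \<in> borel_measurable (lebesgue_on D)"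
      using assms[THEN L2_borel] by measurable
    have "(norm (v x + w x))\<^sup>2 \<le> 2 * (norm (v x))\<^sup>2 + 2 * (norm (w x))\<^sup>2" for x
      using two_inner_le[of "v x" "w x"] by (simp add: power2_norm_eq_inner algebra_simps inner_commute)
    then show "AE x in lebesgue_on D. norm ((norm (v x + w x))\<^sup>2)
        \<le> norm (2 * (norm (v x))\<^sup>2 + 2 * (norm (w x))\<^sup>2)"
      by simp
  qed
  then show ?thesis
    using assms[THEN L2_borel] by (auto simp: L2_def)
qed

lemma L2_uminus: "v \<in> L2 D \<Longrightarrow> (\<lambda>x. - v x) \<in> L2 D"
  using L2_cmult[of v D "-1"] by simp

lemma L2_diff: "v \<in> L2 D \<Longrightarrow> w \<in> L2 D \<Longrightarrow> (\<lambda>x. v x - w x) \<in> L2 D"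
  using L2_add[OF _ L2_uminus] by force

lemma L2_norm_diff_power2:
  assumes "v \<in> L2 D" "w \<in> L2 D"
  shows "(L2_norm D (\<lambda>x. v x - w x))\<^sup>2 = (L2_norm D v)\<^sup>2 - 2 * L2_inner D v w + (L2_norm D w)\<^sup>2"
proof -
  have "(L2_norm D (\<lambda>x. v x - w x))\<^sup>2
      = (LINT x|lebesgue_on D. (norm (v x))\<^sup>2 - 2 * (v x \<bullet> w x) + (norm (w x))\<^sup>2)"
    unfolding L2_norm_power2
    by (intro Bochner_Integration.integral_cong refl)
       (simp add: power2_norm_eq_inner algebra_simps inner_commute)
  also have "\<dots> = (L2_norm D v)\<^sup>2 - 2 * L2_inner D v w + (L2_norm D w)\<^sup>2"
    using assms[THEN L2_integrable_norm2] L2_integrable_inner[OF assms]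
    by (simp add: L2_norm_power2 L2_inner_def)
  finally show ?thesis .
qed

text \<open>Young's inequality for the rescaled vectors \<open>sqrt c *\<^sub>R v x\<close> and
  \<open>(1 / sqrt c) *\<^sub>R w x\<close>, integrated over \<open>D\<close>.\<close>

lemma L2_inner_le_weighted:
  assumes v: "v \<in> L2 D" and w: "w \<in> L2 D" and "0 < c"
  shows "2 * \<bar>L2_inner D v w\<bar> \<le> c * (L2_norm D v)\<^sup>2 + (L2_norm D w)\<^sup>2 / c"
proof -
  have "2 * \<bar>L2_inner D v w\<bar> \<le> 2 * (LINT x|lebesgue_on D. \<bar>v x \<bullet> w x\<bar>)"
    unfolding L2_inner_def by (simp add: integral_abs_bound)
  also have "\<dots> = (LINT x|lebesgue_on D. 2 * \<bar>v x \<bullet> w x\<bar>)"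
    by simp
  also have "\<dots> \<le> (LINT x|lebesgue_on D. c * (norm (v x))\<^sup>2 + (norm (w x))\<^sup>2 / c)"
  proof (rule integral_mono)
    show "integrable (lebesgue_on D) (\<lambda>x. 2 * \<bar>v x \<bullet> w x\<bar>)"
      using L2_integrable_inner[OF v w] by simp
    show "integrable (lebesgue_on D) (\<lambda>x. c * (norm (v x))\<^sup>2 + (norm (w x))\<^sup>2 / c)"
      using v[THEN L2_integrable_norm2] w[THEN L2_integrable_norm2] by simp
    fix x
    have "2 * \<bar>(sqrt c *\<^sub>R v x) \<bullet> ((1 / sqrt c) *\<^sub>R w x)\<bar>
        \<le> (norm (sqrt c *\<^sub>R v x))\<^sup>2 + (norm ((1 / sqrt c) *\<^sub>R w x))\<^sup>2"
      by (rule two_inner_le)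
    then show "2 * \<bar>v x \<bullet> w x\<bar> \<le> c * (norm (v x))\<^sup>2 + (norm (w x))\<^sup>2 / c"
      using \<open>0 < c\<close> by (simp add: power_mult_distrib power_divide)
  qed
  also have "\<dots> = c * (L2_norm D v)\<^sup>2 + (L2_norm D w)\<^sup>2 / c"
    using v[THEN L2_integrable_norm2] w[THEN L2_integrable_norm2] by (simp add: L2_norm_power2)
  finally show ?thesis .
qed

text \<open>The weight \<open>B / A\<close> would turn the weighted inequality into the bound
  \<open>2 * A * B\<close>; shifting both norms by a small \<open>d\<close> keeps the weight
  positive and finite when a norm vanishes.\<close>

lemma L2_Cauchy_Schwarz:
  assumes v: "v \<in> L2 D" and w: "w \<in> L2 D"
  shows "\<bar>L2_inner D v w\<bar> \<le> L2_norm D v * L2_norm D w"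
proof (rule field_le_epsilon)
  fix e :: real assume "0 < e"
  define A where "A = L2_norm D v" define B where "B = L2_norm D w"
  have nn: "0 \<le> A" "0 \<le> B" by (simp_all add: A_def B_def)
  \<comment> \<open>The shift costs at most \<open>d * (A + B)\<close>, which this choice keeps
    below \<open>e\<close>.\<close>
  define d where "d = e / (A + B + 1)"
  have d: "0 < d" using \<open>0 < e\<close> nn by (simp add: d_def)
  have "2 * \<bar>L2_inner D v w\<bar> \<le> (B + d) / (A + d) * A\<^sup>2 + B\<^sup>2 / ((B + d) / (A + d))"
    unfolding A_def B_def
    by (rule L2_inner_le_weighted[OF v w]) (use nn d in \<open>simp add: A_def B_def add_nonneg_pos\<close>)
  also have "\<dots> = (B + d) * (A * (A / (A + d))) + (A + d) * (B * (B / (B + d)))"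
    by (simp add: power2_eq_square)
  also have "\<dots> \<le> (B + d) * (A * 1) + (A + d) * (B * 1)"
    using nn d by (intro add_mono mult_left_mono) auto
  also have "\<dots> \<le> 2 * (A * B) + d * (A + B + 1)"
    using d by (simp add: algebra_simps)
  also have "\<dots> = 2 * (A * B) + e"
    using nn by (simp add: d_def)
  finally show "\<bar>L2_inner D v w\<bar> \<le> L2_norm D v * L2_norm D w + e"
    using \<open>0 < e\<close> by (simp add: A_def B_def)
qed

lemma L2_norm_eq_0_iff:
  assumes "v \<in> L2 D"
  shows "L2_norm D v = 0 \<longleftrightarrow> (AE x in lebesgue_on D. v x = 0)"
proof -
  have "L2_norm D v = 0 \<longleftrightarrow> (LINT x|lebesgue_on D. (norm (v x))\<^sup>2) = 0"
    by (simp flip: L2_norm_power2)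
  also have "\<dots> \<longleftrightarrow> (AE x in lebesgue_on D. (norm (v x))\<^sup>2 = 0)"
    by (rule integral_nonneg_eq_0_iff_AE) (use L2_integrable_norm2[OF assms] in auto)
  finally show ?thesis by simp
qed

lemma L2_norm_cong_AE:
  assumes "v \<in> L2 D" "w \<in> L2 D" "AE x in lebesgue_on D. v x = w x"
  shows "L2_norm D v = L2_norm D w"
  unfolding L2_norm_def L2_inner_def
proof (intro arg_cong[of _ _ sqrt] integral_cong_AE)
  show "(\<lambda>x. v x \<bullet> v x) \<in> borel_measurable (lebesgue_on D)"
    "(\<lambda>x. w x \<bullet> w x) \<in> borel_measurable (lebesgue_on D)"
    using assms(1,2)[THEN L2_borel] by measurable
  show "AE x in lebesgue_on D. v x \<bullet> v x = w x \<bullet> w x"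
    using assms(3) by eventually_elim simp
qed

lemma L2_norm_uminus: "L2_norm D (\<lambda>x. - v x) = L2_norm D v"
  by (simp add: L2_norm_def L2_inner_def)

text \<open>Cauchy-Schwarz for \<open>v k - v'\<close>; this carries identities for test functions
  over to their limits.\<close>

lemma tendsto_L2_inner:
  assumes "\<And>k. v k \<in> L2 D" "v' \<in> L2 D" "w \<in> L2 D"
    and lim: "(\<lambda>k. L2_norm D (\<lambda>x. v k x - v' x)) \<longlonglongrightarrow> 0"
  shows "(\<lambda>k. L2_inner D (v k) w) \<longlonglongrightarrow> L2_inner D v' w"
proof -
  have "(\<lambda>k. L2_inner D (v k) w - L2_inner D v' w) \<longlonglongrightarrow> 0"
  proof (rule tendsto_rabs_zero_cancel, rule tendsto_sandwich[where f = "\<lambda>_. 0"])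
    show "(\<lambda>k. L2_norm D (\<lambda>x. v k x - v' x) * L2_norm D w) \<longlonglongrightarrow> 0"
      using tendsto_mult_right[OF lim, of "L2_norm D w"] by simp
    show "\<forall>\<^sub>F k in sequentially. \<bar>L2_inner D (v k) w - L2_inner D v' w\<bar>
        \<le> L2_norm D (\<lambda>x. v k x - v' x) * L2_norm D w"
    proof (intro always_eventually allI)
      fix k
      have "L2_inner D (v k) w - L2_inner D v' w = L2_inner D (\<lambda>x. v k x - v' x) w"
        using assms(1-3) by (simp add: L2_inner_def inner_diff_left L2_integrable_inner)
      then show "\<bar>L2_inner D (v k) w - L2_inner D v' w\<bar>
        \<le> L2_norm D (\<lambda>x. v k x - v' x) * L2_norm D w"
        using L2_Cauchy_Schwarz[OF L2_diff[OF assms(1,2)] assms(3), of k] by simp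
    qed
  qed auto
  then show ?thesis by (simp add: LIM_zero_iff)
qed

section \<open>Uniqueness of weak gradients\<close>

lemma integrable_lborel_compact_support:
  fixes f :: "'a::euclidean_space \<Rightarrow> real"
  assumes f: "continuous_on UNIV f" and S: "compact S" "\<And>x. x \<notin> S \<Longrightarrow> f x = 0"
  shows "integrable lborel f"
proof -
  have "bounded (f ` S)"
    by (intro compact_imp_bounded compact_continuous_image continuous_on_subset[OF f] S) auto
  then obtain K where K: "\<And>x. x \<in> S \<Longrightarrow> \<bar>f x\<bar> \<le> K"
    by (auto simp: bounded_iff)
  show ?thesis
  proof (rule Bochner_Integration.integrable_bound)
    show "integrable lborel (\<lambda>x. K * indicator S x)"
      using S(1) by (intro integrable_mult_right integrable_real_indicator emeasure_bounded_finite)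
        (auto intro: compact_imp_bounded borel_compact)
    show "f \<in> borel_measurable lborel"
      using borel_measurable_continuous_onI[OF f] by simp
    show "AE x in lborel. norm (f x) \<le> norm (K * indicator S x)"
      using K S(2) by (intro AE_I2) (force simp: indicator_def)
  qed
qed

text \<open>By translation invariance \<open>\<integral> F(x + s e) dx\<close> does not depend on \<open>s\<close>.\<close>

lemma integral_line_derivative_eq_0:
  fixes F g :: "'a::euclidean_space \<Rightarrow> real"
  assumes F: "continuous_on UNIV F" and g: "continuous_on UNIV g"
    and deriv: "\<And>x. ((\<lambda>s. F (x + s *\<^sub>R e)) has_real_derivative g x) (at 0)"
    and S: "compact S" "\<And>x. x \<notin> S \<Longrightarrow> F x = 0"
  shows "x \<notin> S \<Longrightarrow> g x = 0" and "(LINT x|lborel. g x) = 0"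
proof -
  show g0: "g x = 0" if "x \<notin> S" for x
  proof -
    \<comment> \<open>Near \<open>s = 0\<close> the line stays in the open complement of
      \<open>S\<close>, where \<open>F\<close> vanishes.\<close>
    have "open ((\<lambda>s. x + s *\<^sub>R e) -` (- S))"
      using compact_imp_closed[OF S(1)]
      by (intro open_vimage continuous_intros) auto
    then have "((\<lambda>s. 0) has_real_derivative g x) (at 0)"
      by (rule has_field_derivative_transform_within_open[OF deriv]) (use that S(2) in auto)
    then show "g x = 0"
      using DERIV_unique DERIV_const by blast
  qed
  \<comment> \<open>The mean value theorem needs the derivative along the whole line; moving the
    base point to \<open>x + s *\<^sub>R e\<close> reduces this to the derivative at
    \<open>0\<close>.\<close>
  have deriv': "((\<lambda>s. F (x + s *\<^sub>R e)) has_real_derivative g (x + s *\<^sub>R e)) (at s)" for x s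
  proof -
    have "((\<lambda>r. F (x + (r + s) *\<^sub>R e)) has_real_derivative g (x + s *\<^sub>R e)) (at 0)"
      using deriv[of "x + s *\<^sub>R e"] by (simp add: algebra_simps)
    then show ?thesis
      using DERIV_shift[of "\<lambda>s. F (x + s *\<^sub>R e)" _ 0 s] by simp
  qed
  have "bounded (g ` S)"
    by (intro compact_imp_bounded compact_continuous_image continuous_on_subset[OF g] S) auto
  then obtain K where "\<And>x. x \<in> S \<Longrightarrow> \<bar>g x\<bar> \<le> K"
    by (auto simp: bounded_iff)
  then have K: "\<bar>g x\<bar> \<le> max K 0" for x
    using g0[of x] by (cases "x \<in> S") force+
  obtain R where R: "\<And>x. x \<in> S \<Longrightarrow> norm x \<le> R"
    using compact_imp_bounded[OF S(1)] by (auto simp: bounded_iff)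
  \<comment> \<open>Since \<open>t n \<le> 1\<close>, neither \<open>x\<close> nor
    \<open>x + t n *\<^sub>R e\<close> lies in \<open>S\<close> when \<open>x\<close> is outside
    this enlarged ball. The difference quotients thus vanish off \<open>B\<close>, and on
    \<open>B\<close> the mean value theorem bounds them by \<open>max K 0\<close>.\<close>
  define B where "B = cball (0::'a) (R + norm e)"
  define t :: "nat \<Rightarrow> real" where "t n = inverse (real (Suc n))" for n
  have t: "0 < t n" "t n \<le> 1" for n by (auto simp: t_def field_simps)
  define d where "d n x = (F (x + t n *\<^sub>R e) - F x) / t n" for n x
  have d_bound: "\<bar>d n x\<bar> \<le> max K 0 * indicator B x" for n x
  proof (cases "x \<in> B")
    case True
    obtain z where "F (x + t n *\<^sub>R e) - F (x + 0 *\<^sub>R e) = (t n - 0) * g (x + z *\<^sub>R e)"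
      using MVT2[OF t(1) deriv'] by blast
    then have "d n x = g (x + z *\<^sub>R e)"
      using t(1)[of n] by (simp add: d_def)
    with True K show ?thesis by simp
  next
    case False
    then have "R + norm e < norm x" by (simp add: B_def)
    moreover have "norm x \<le> norm (x + t n *\<^sub>R e) + norm (t n *\<^sub>R e)"
      by (metis add_diff_cancel_right' norm_triangle_ineq4)
    moreover have "norm (t n *\<^sub>R e) \<le> norm e"
      using t[of n] by (simp add: mult_left_le_one_le)
    ultimately have "R < norm (x + t n *\<^sub>R e)" "R < norm x"
      using norm_ge_zero[of e] by linarith+
    then have "x + t n *\<^sub>R e \<notin> S" "x \<notin> S" using R by force+
    with False S(2) show ?thesis by (simp add: d_def)
  qed
  have intF: "integrable lborel F"
    using F S by (rule integrable_lborel_compact_support)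
  have shift: "integrable lborel (\<lambda>x. F (x + c))" "(LINT x|lborel. F (x + c)) = (LINT x|lborel. F x)"
    for c
  proof -
    have "integrable (distr lborel borel ((+) c)) F"
      using intF by (simp add: lborel_distr_plus)
    then show "integrable lborel (\<lambda>x. F (x + c))"
      by (subst (asm) integrable_distr_eq)
        (use borel_measurable_continuous_onI[OF F] in \<open>auto simp: add.commute\<close>)
    show "(LINT x|lborel. F (x + c)) = (LINT x|lborel. F x)"
      using integral_distr[of "(+) c" lborel borel F] borel_measurable_continuous_onI[OF F]
      by (simp add: lborel_distr_plus add.commute)
  qed
  have d0: "(LINT x|lborel. d n x) = 0" for n
    unfolding d_def using intF shift by simp
  have "(\<lambda>n. LINT x|lborel. d n x) \<longlonglongrightarrow> (LINT x|lborel. g x)"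
  proof (rule integral_dominated_convergence)
    show "g \<in> borel_measurable lborel"
      using borel_measurable_continuous_onI[OF g] by simp
    show "d n \<in> borel_measurable lborel" for n
      unfolding d_def using borel_measurable_integrable[OF shift(1)] borel_measurable_integrable[OF intF]
      by (intro borel_measurable_divide borel_measurable_diff) auto
    show "integrable lborel (\<lambda>x. max K 0 * indicator B x)"
      by (intro integrable_mult_right integrable_real_indicator emeasure_bounded_finite)
        (auto simp: B_def)
    show "AE x in lborel. norm (d n x) \<le> max K 0 * indicator B x" for n
      using d_bound by auto
    show "AE x in lborel. (\<lambda>n. d n x) \<longlonglongrightarrow> g x"
    proof (rule AE_I2)
      fix x
      have "((\<lambda>h. (F (x + h *\<^sub>R e) - F x) / h) \<longlongrightarrow> g x) (at 0)"
        using deriv[of x] by (simp add: DERIV_def)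
      moreover have "filterlim t (at 0) sequentially"
        unfolding filterlim_at
        using t(1) LIMSEQ_inverse_real_of_nat unfolding t_def by (auto simp: less_imp_neq[symmetric])
      ultimately show "(\<lambda>n. d n x) \<longlonglongrightarrow> g x"
        unfolding d_def by (rule filterlim_compose)
    qed
  qed
  then show "(LINT x|lborel. g x) = 0"
    by (simp add: d0 LIMSEQ_const_iff)
qed

text \<open>Polynomials serve as multipliers in the weak formulation of the gradient: their
  derivatives are again polynomials, and they are uniformly dense on compact sets. They need not
  vanish on the boundary, since the other factor has compact support.\<close>

lemma real_polynomial_function_line_derivative:
  assumes "real_polynomial_function q"
  shows "\<exists>q'. real_polynomial_function q' \<and>
    (\<forall>x. ((\<lambda>s. q (x + s *\<^sub>R e)) has_real_derivative q' x) (at 0))"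
  using assms
proof (induction q rule: real_polynomial_function.induct)
  case (linear f)
  interpret bounded_linear f by fact
  have "((\<lambda>s. f (x + s *\<^sub>R e)) has_real_derivative f e) (at 0)" for x
    by (simp add: add scaleR) (auto intro!: derivative_eq_intros)
  then show ?case by blast
next
  case (const c)
  then show ?case by (intro exI[of _ "\<lambda>x. 0"]) auto
next
  case (add f g)
  then obtain f' g' where "real_polynomial_function f'" "real_polynomial_function g'"
    "\<And>x. ((\<lambda>s. f (x + s *\<^sub>R e)) has_real_derivative f' x) (at 0)"
    "\<And>x. ((\<lambda>s. g (x + s *\<^sub>R e)) has_real_derivative g' x) (at 0)" by blast
  then show ?case
    by (intro exI[of _ "\<lambda>x. f' x + g' x"]) (auto intro!: derivative_eq_intros)
next
  case (mult f g)
  then obtain f' g' where *: "real_polynomial_function f'" "real_polynomial_function g'"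
    "\<And>x. ((\<lambda>s. f (x + s *\<^sub>R e)) has_real_derivative f' x) (at 0)"
    "\<And>x. ((\<lambda>s. g (x + s *\<^sub>R e)) has_real_derivative g' x) (at 0)" by blast
  have "((\<lambda>s. f (x + s *\<^sub>R e) * g (x + s *\<^sub>R e)) has_real_derivative f x * g' x + f' x * g x) (at 0)" for x
    using DERIV_mult[OF *(3,4)[of x]] by (simp add: ac_simps)
  then show ?case
    using * mult.hyps by (intro exI[of _ "\<lambda>x. f x * g' x + f' x * g x"]) auto
qed

lemma continuous_on_real_polynomial_function:
  "real_polynomial_function q \<Longrightarrow> continuous_on S q"
  by (simp add: continuous_on_polymonial_function real_polynomial_function_eq)

section \<open>Integration by parts with polynomial multipliers\<close>

lemma test_function_continuous: "\<phi> \<in> test_functions D \<Longrightarrow> continuous_on UNIV \<phi>"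
  by (auto simp: test_functions_def dest!: spec[of _ 0])

text \<open>\<open>Ck\<close> only provides some partial derivatives \<open>g\<close>; uniqueness of
  the Frechet derivative identifies them with the components of
  \<open>classical_grad\<close>.\<close>

lemma test_function_has_derivative:
  assumes "\<phi> \<in> test_functions D"
  shows "(\<phi> has_derivative (\<lambda>y. \<Sum>i\<in>UNIV. classical_grad \<phi> x $ i * y $ i)) (at x)"
    and "continuous_on UNIV (\<lambda>x. classical_grad \<phi> x $ i)"
proof -
  have "Ck (Suc 0) \<phi>" using assms by (auto simp: test_functions_def)
  then obtain g where g: "\<And>x. (\<phi> has_derivative (\<lambda>y. \<Sum>i\<in>UNIV. g i x * y $ i)) (at x)"
    "\<And>i. continuous_on UNIV (g i)" by auto
  have "classical_grad \<phi> x $ i = g i x" for x i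
    by (simp add: classical_grad_def frechet_derivative_at[OF g(1), symmetric] axis_def
        if_distrib cong: if_cong)
  with g show "(\<phi> has_derivative (\<lambda>y. \<Sum>i\<in>UNIV. classical_grad \<phi> x $ i * y $ i)) (at x)"
    "continuous_on UNIV (\<lambda>x. classical_grad \<phi> x $ i)" by simp_all
qed

lemma test_function_line_derivative:
  assumes "\<phi> \<in> test_functions D"
  shows "((\<lambda>s. \<phi> (x + s *\<^sub>R axis i 1)) has_real_derivative classical_grad \<phi> x $ i) (at 0)"
proof -
  have "((\<lambda>s. x + s *\<^sub>R axis i 1) has_derivative (\<lambda>s. s *\<^sub>R axis i 1)) (at 0)"
    by (auto intro!: derivative_eq_intros)
  moreover have "(\<phi> has_derivative (\<lambda>y. \<Sum>i\<in>UNIV. classical_grad \<phi> x $ i * y $ i))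
      (at (x + 0 *\<^sub>R axis i 1))"
    using test_function_has_derivative(1)[OF assms] by simp
  ultimately have "(\<phi> \<circ> (\<lambda>s. x + s *\<^sub>R axis i 1) has_derivative
      (\<lambda>y. \<Sum>i\<in>UNIV. classical_grad \<phi> x $ i * y $ i) \<circ> (\<lambda>s. s *\<^sub>R axis i 1)) (at 0)"
    by (rule diff_chain_at)
  moreover have "(\<lambda>y. \<Sum>i\<in>UNIV. classical_grad \<phi> x $ i * y $ i) \<circ> (\<lambda>s. s *\<^sub>R axis i 1)
      = (*) (classical_grad \<phi> x $ i)"
    by (auto simp: fun_eq_iff axis_def if_distrib cong: if_cong)
  ultimately show ?thesis by (simp add: has_field_derivative_def o_def)
qed

text \<open>Links the two measures in use: norms are taken over \<open>lebesgue_on D\<close>, while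
  translation invariance is exploited for \<open>lborel\<close>.\<close>

lemma integral_lebesgue_on_eq_lborel:
  fixes f :: "'a::euclidean_space \<Rightarrow> real"
  assumes "D \<in> sets lebesgue" "f \<in> borel_measurable borel" "\<And>x. x \<notin> D \<Longrightarrow> f x = 0"
  shows "(LINT x|lebesgue_on D. f x) = (LINT x|lborel. f x)"
proof -
  have "(LINT x|lebesgue_on D. f x) = (LINT x|lebesgue. indicator D x *\<^sub>R f x)"
    using assms(1) by (subst integral_restrict_space) auto
  also have "\<dots> = (LINT x|lebesgue. f x)"
    by (intro Bochner_Integration.integral_cong refl) (use assms(3) in \<open>auto simp: indicator_def\<close>)
  also have "\<dots> = (LINT x|lborel. f x)"
    using assms(2) by (intro integral_completion) simp
  finally show ?thesis .
qed

text \<open>By the product rule, the sum of the two integrands is the line derivative of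
  \<open>\<phi> x * q x\<close>, which has compact support in \<open>D\<close>. Such a derivative
  integrates to zero, so no boundary term appears.\<close>

lemma test_function_integral_by_parts:
  assumes \<phi>: "\<phi> \<in> test_functions D" and D: "open D"
    and q: "real_polynomial_function q" and q': "real_polynomial_function q'"
    and deriv: "\<And>x. ((\<lambda>s. q (x + s *\<^sub>R axis i 1)) has_real_derivative q' x) (at 0)"
  shows "L2_inner D (\<lambda>x. classical_grad \<phi> x $ i) q = - L2_inner D \<phi> q'"
proof -
  let ?d = "\<lambda>x. classical_grad \<phi> x $ i"
  define S where "S = closure {x. \<phi> x \<noteq> 0}"
  have S: "compact S" "S \<subseteq> D" using \<phi> by (auto simp: S_def test_functions_def)
  have \<phi>0: "\<phi> x = 0" if "x \<notin> S" for x
    using that closure_subset[of "{x. \<phi> x \<noteq> 0}"] by (auto simp: S_def)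
  note cont = test_function_continuous[OF \<phi>] test_function_has_derivative(2)[OF \<phi>]
    continuous_on_real_polynomial_function[OF q, of UNIV]
    continuous_on_real_polynomial_function[OF q', of UNIV]
  have d0: "?d x = 0" if "x \<notin> S" for x
    using cont(1,2) test_function_line_derivative[OF \<phi>] S(1) \<phi>0 that
    by (rule integral_line_derivative_eq_0(1))
  have "(LINT x|lborel. ?d x * q x + \<phi> x * q' x) = 0"
  proof (rule integral_line_derivative_eq_0(2))
    show "continuous_on UNIV (\<lambda>x. \<phi> x * q x)" "continuous_on UNIV (\<lambda>x. ?d x * q x + \<phi> x * q' x)"
      by (intro continuous_on_add continuous_on_mult cont)+
    show "((\<lambda>s. \<phi> (x + s *\<^sub>R axis i 1) * q (x + s *\<^sub>R axis i 1)) has_real_derivative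
        ?d x * q x + \<phi> x * q' x) (at 0)" for x
      using DERIV_mult[OF test_function_line_derivative[OF \<phi>, of x i] deriv[of x]]
      by (simp add: ac_simps)
    show "compact S" by fact
    show "\<phi> x * q x = 0" if "x \<notin> S" for x using \<phi>0[OF that] by simp
  qed
  moreover have prods: "continuous_on UNIV (\<lambda>x. ?d x * q x)" "continuous_on UNIV (\<lambda>x. \<phi> x * q' x)"
    by (intro continuous_on_mult cont)+
  moreover have "integrable lborel (\<lambda>x. ?d x * q x)"
    by (rule integrable_lborel_compact_support[OF prods(1) S(1)]) (simp add: d0)
  moreover have "integrable lborel (\<lambda>x. \<phi> x * q' x)"
    by (rule integrable_lborel_compact_support[OF prods(2) S(1)]) (simp add: \<phi>0)
  ultimately have "(LINT x|lborel. ?d x * q x) = - (LINT x|lborel. \<phi> x * q' x)"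
    by simp
  moreover have "L2_inner D ?d q = (LINT x|lborel. ?d x * q x)"
    unfolding L2_inner_def inner_real_def
    by (rule integral_lebesgue_on_eq_lborel[OF _ borel_measurable_continuous_onI[OF prods(1)]])
      (use D S(2) d0 in auto)
  moreover have "L2_inner D \<phi> q' = (LINT x|lborel. \<phi> x * q' x)"
    unfolding L2_inner_def inner_real_def
    by (rule integral_lebesgue_on_eq_lborel[OF _ borel_measurable_continuous_onI[OF prods(2)]])
      (use D S(2) \<phi>0 in auto)
  ultimately show ?thesis by simp
qed

lemma finite_measure_lebesgue_on_bounded:
  "open D \<Longrightarrow> bounded D \<Longrightarrow> finite_measure (lebesgue_on (D :: (real^'d) set))"
  by (intro finite_measure_lebesgue_on bounded_set_imp_lmeasurable) auto

lemma L2_bounded: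
  fixes f :: "(real^'d) \<Rightarrow> 'b::euclidean_space"
  assumes "finite_measure (lebesgue_on D)" "f \<in> borel_measurable (lebesgue_on D)"
    and K: "AE x in lebesgue_on D. norm (f x) \<le> K"
  shows "f \<in> L2 D"
proof -
  interpret finite_measure "lebesgue_on D" by fact
  have "integrable (lebesgue_on D) (\<lambda>x. (norm (f x))\<^sup>2)"
  proof (rule integrable_const_bound)
    show "AE x in lebesgue_on D. norm ((norm (f x))\<^sup>2) \<le> K\<^sup>2"
      using K by eventually_elim (auto intro: power_mono)
    show "(\<lambda>x. (norm (f x))\<^sup>2) \<in> borel_measurable (lebesgue_on D)"
      using assms(2) by measurable
  qed
  with assms(2) show ?thesis by (simp add: L2_def)
qed

lemma continuous_borel_measurable_lebesgue_on:
  fixes f :: "(real^'d) \<Rightarrow> 'b::euclidean_space"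
  shows "continuous_on UNIV f \<Longrightarrow> f \<in> borel_measurable (lebesgue_on D)"
  by (intro measurable_restrict_space1 measurable_completion) (simp add: borel_measurable_continuous_onI)

lemma L2_continuous:
  fixes f :: "(real^'d) \<Rightarrow> 'b::euclidean_space"
  assumes f: "continuous_on UNIV f" and D: "open D" "bounded D"
  shows "f \<in> L2 D"
proof -
  have "bounded (f ` closure D)"
    by (intro compact_imp_bounded compact_continuous_image continuous_on_subset[OF f])
      (use D in auto)
  then obtain K where "\<And>x. x \<in> closure D \<Longrightarrow> norm (f x) \<le> K"
    by (auto simp: bounded_iff)
  then have "AE x in lebesgue_on D. norm (f x) \<le> K"
    using closure_subset by (intro AE_I2) auto
  with f D show ?thesis
    by (intro L2_bounded finite_measure_lebesgue_on_bounded continuous_borel_measurable_lebesgue_on)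
qed

text \<open>The identity holds for the approximating test functions, and both sides are continuous
  in the L2 norm.\<close>

lemma has_H10_grad_integral_by_parts:
  assumes v: "has_H10_grad D v G" and D: "open D" "bounded D"
    and q: "real_polynomial_function q" and q': "real_polynomial_function q'"
    and deriv: "\<And>x. ((\<lambda>s. q (x + s *\<^sub>R axis i 1)) has_real_derivative q' x) (at 0)"
  shows "L2_inner D (\<lambda>x. G x $ i) q = - L2_inner D v q'"
proof -
  obtain \<phi> where \<phi>: "\<And>k. \<phi> k \<in> test_functions D"
    and lim: "(\<lambda>k. L2_norm D (\<lambda>x. \<phi> k x - v x)) \<longlonglongrightarrow> 0"
      "(\<lambda>k. L2_norm D (\<lambda>x. classical_grad (\<phi> k) x - G x)) \<longlonglongrightarrow> 0"
    and L2: "v \<in> L2 D" "G \<in> L2 D"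
    using v unfolding has_H10_grad_def by blast
  note cont = continuous_on_real_polynomial_function[OF q, of UNIV]
    continuous_on_real_polynomial_function[OF q', of UNIV]
  have "(\<lambda>k. L2_inner D (\<phi> k) q') \<longlonglongrightarrow> L2_inner D v q'"
    by (intro tendsto_L2_inner lim L2 L2_continuous test_function_continuous[OF \<phi>] cont D)
  \<comment> \<open>The gradients converge as vector fields, so component \<open>i\<close> is read
    off by pairing with \<open>q x *\<^sub>R axis i 1\<close>.\<close>
  moreover have "(\<lambda>k. L2_inner D (classical_grad (\<phi> k)) (\<lambda>x. q x *\<^sub>R axis i 1))
      \<longlonglongrightarrow> L2_inner D G (\<lambda>x. q x *\<^sub>R axis i 1)"
  proof (intro tendsto_L2_inner lim L2 L2_continuous D)
    show "continuous_on UNIV (classical_grad (\<phi> k))" for k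
      using continuous_on_vec_lambda[of UNIV "\<lambda>i x. classical_grad (\<phi> k) x $ i"]
        test_function_has_derivative(2)[OF \<phi>] by simp
    show "continuous_on UNIV (\<lambda>x. q x *\<^sub>R axis i 1 :: real^'a)"
      using cont by (intro continuous_intros)
  qed
  then have "(\<lambda>k. L2_inner D (\<lambda>x. classical_grad (\<phi> k) x $ i) q) \<longlonglongrightarrow> L2_inner D (\<lambda>x. G x $ i) q"
    by (simp add: L2_inner_def inner_axis mult.commute)
  then have "(\<lambda>k. - L2_inner D (\<phi> k) q') \<longlonglongrightarrow> L2_inner D (\<lambda>x. G x $ i) q"
    by (simp add: test_function_integral_by_parts[OF \<phi> D(1) q q' deriv])
  ultimately show ?thesis
    using LIMSEQ_unique tendsto_minus by blast
qed

section \<open>Functions orthogonal to all polynomials\<close>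

lemma L2_imp_integrable:
  fixes h :: "(real^'d) \<Rightarrow> real"
  assumes "h \<in> L2 D" "open D" "bounded D"
  shows "integrable (lebesgue_on D) h"
  using L2_integrable_inner[OF assms(1) L2_continuous[of "\<lambda>_. 1", OF continuous_on_const assms(2,3)]] by simp

text \<open>A measurable function is an almost everywhere limit of continuous functions; applied to
  \<open>sgn h\<close>, this gives \<open>\<integral>\<bar>h\<bar> = 0\<close>.\<close>

lemma L2_orthogonal_polynomials_eq_0:
  fixes h :: "(real^'d) \<Rightarrow> real"
  assumes h: "h \<in> L2 D" and D: "open D" "bounded D"
    and orth: "\<And>q. real_polynomial_function q \<Longrightarrow> L2_inner D h q = 0"
  shows "AE x in lebesgue_on D. h x = 0"
proof -
  have int: "integrable (lebesgue_on D) h"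
    using h D by (rule L2_imp_integrable)
  define I where "I = (LINT x|lebesgue_on D. \<bar>h x\<bar>)"
  \<comment> \<open>Stone-Weierstrass on the compact set \<open>closure D\<close> extends the
    orthogonality from polynomials to continuous functions.\<close>
  have cont: "(LINT x|lebesgue_on D. h x * c x) = 0" if c: "continuous_on UNIV c" for c
  proof -
    have "\<bar>LINT x|lebesgue_on D. h x * c x\<bar> \<le> 0 + e" if "0 < e" for e
    proof -
      \<comment> \<open>The uniform error gets multiplied by the integral \<open>I\<close> of
        \<open>\<bar>h x\<bar>\<close>; the added \<open>1\<close> covers
        \<open>I = 0\<close>.\<close>
      define e' where "e' = e / (I + 1)"
      have I: "0 \<le> I" by (simp add: I_def)
      then have "0 < e'" using that by (simp add: e'_def)
      obtain q where q: "real_polynomial_function q" "\<And>x. x \<in> closure D \<Longrightarrow> \<bar>c x - q x\<bar> < e'"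
        using Stone_Weierstrass_real_polynomial_function[of "closure D" c e'] D c \<open>0 < e'\<close>
          continuous_on_subset[OF c] by auto
      have i: "integrable (lebesgue_on D) (\<lambda>x. h x * c x)" "integrable (lebesgue_on D) (\<lambda>x. h x * q x)"
        using L2_integrable_inner[OF h L2_continuous[OF c D]]
          L2_integrable_inner[OF h L2_continuous[OF continuous_on_real_polynomial_function[OF q(1)] D]]
        by simp_all
      have "(LINT x|lebesgue_on D. h x * c x) = (LINT x|lebesgue_on D. h x * c x - h x * q x)"
        using orth[OF q(1)] i by (simp add: L2_inner_def)
      also have "\<bar>\<dots>\<bar> \<le> (LINT x|lebesgue_on D. \<bar>h x * c x - h x * q x\<bar>)"
        by (rule integral_abs_bound)
      also have "\<dots> \<le> (LINT x|lebesgue_on D. e' * \<bar>h x\<bar>)"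
      proof (rule integral_mono)
        show "integrable (lebesgue_on D) (\<lambda>x. \<bar>h x * c x - h x * q x\<bar>)"
          using i by simp
        show "integrable (lebesgue_on D) (\<lambda>x. e' * \<bar>h x\<bar>)"
          using int by simp
        fix x assume "x \<in> space (lebesgue_on D)"
        then have "\<bar>c x - q x\<bar> \<le> e'"
          using q(2)[of x] closure_subset[of D] by auto
        then have "\<bar>c x - q x\<bar> * \<bar>h x\<bar> \<le> e' * \<bar>h x\<bar>"
          by (intro mult_right_mono) auto
        moreover have "h x * c x - h x * q x = (c x - q x) * h x"
          by (simp add: algebra_simps)
        ultimately show "\<bar>h x * c x - h x * q x\<bar> \<le> e' * \<bar>h x\<bar>"
          by (simp only: abs_mult)
      qed
      also have "\<dots> = e' * I" by (simp add: I_def)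
      also have "\<dots> \<le> e"
        using I that by (simp add: e'_def field_simps)
      finally show ?thesis by simp
    qed
    then have "\<bar>LINT x|lebesgue_on D. h x * c x\<bar> \<le> 0"
      by (rule field_le_epsilon)
    then show ?thesis by simp
  qed
  have "(\<lambda>x. sgn (h x)) \<in> borel_measurable (lebesgue_on D)"
    using L2_borel[OF h] by measurable
  then have "(\<lambda>x. sgn (h x)) measurable_on D"
    using D by (subst measurable_on_iff_borel_measurable) auto
  then obtain N g where N: "negligible N" and g: "\<And>n. continuous_on UNIV (g n)"
    "\<And>x. x \<notin> N \<Longrightarrow> (\<lambda>n. g n x) \<longlonglongrightarrow> (if x \<in> D then sgn (h x) else 0)"
    unfolding measurable_on_def by metis
  \<comment> \<open>Truncation to \<open>[-1, 1]\<close> preserves continuity and the limit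
    \<open>sgn (h x)\<close>, and it provides the integrable majorant
    \<open>\<bar>h x\<bar>\<close>.\<close>
  define c where "c n x = max (-1) (min 1 (g n x))" for n :: nat and x
  have c_cont: "continuous_on UNIV (c n)" for n
    unfolding c_def using g(1) by (intro continuous_intros)
  have "(\<lambda>n. LINT x|lebesgue_on D. h x * c n x) \<longlonglongrightarrow> (LINT x|lebesgue_on D. h x * sgn (h x))"
  proof (rule integral_dominated_convergence)
    show "(\<lambda>x. h x * sgn (h x)) \<in> borel_measurable (lebesgue_on D)"
      using L2_borel[OF h] by measurable
    show "(\<lambda>x. h x * c n x) \<in> borel_measurable (lebesgue_on D)" for n
      using L2_borel[OF h] continuous_borel_measurable_lebesgue_on[OF c_cont] by measurable
    show "integrable (lebesgue_on D) (\<lambda>x. \<bar>h x\<bar>)" using int by simp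
    show "AE x in lebesgue_on D. norm (h x * c n x) \<le> \<bar>h x\<bar>" for n
    proof (rule AE_I2)
      fix x
      have "\<bar>c n x\<bar> \<le> 1" by (auto simp: c_def)
      then show "norm (h x * c n x) \<le> \<bar>h x\<bar>"
        by (simp add: abs_mult mult_left_le)
    qed
    have "AE x in lebesgue_on D. x \<notin> N"
    proof -
      have "AE x in lebesgue. x \<notin> N"
        using N by (intro AE_not_in) (simp add: negligible_iff_null_sets)
      then show ?thesis using D by (subst AE_restrict_space_iff) auto
    qed
    then show "AE x in lebesgue_on D. (\<lambda>n. h x * c n x) \<longlonglongrightarrow> h x * sgn (h x)"
      using AE_space
    proof eventually_elim
      case (elim x)
      then have "(\<lambda>n. g n x) \<longlonglongrightarrow> sgn (h x)" using g(2)[of x] by simp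
      then have "(\<lambda>n. c n x) \<longlonglongrightarrow> max (-1) (min 1 (sgn (h x)))"
        unfolding c_def by (intro tendsto_intros)
      moreover have "max (-1) (min 1 (sgn (h x))) = sgn (h x)"
        by (auto simp: sgn_if)
      ultimately show ?case by (intro tendsto_intros) simp
    qed
  qed
  then have "(LINT x|lebesgue_on D. \<bar>h x\<bar>) = 0"
    by (simp add: cont[OF c_cont] LIMSEQ_const_iff abs_sgn)
  then show ?thesis
    using int by (subst (asm) integral_nonneg_eq_0_iff_AE) auto
qed

lemma L2_nth: "G \<in> L2 D \<Longrightarrow> (\<lambda>x. G x $ i) \<in> L2 (D :: (real^'d) set)"
  for G :: "real^'d \<Rightarrow> real^'d"
proof -
  assume G: "G \<in> L2 D"
  have m: "(\<lambda>x. G x $ i) \<in> borel_measurable (lebesgue_on D)"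
    by (rule measurable_compose[OF L2_borel[OF G] borel_measurable_continuous_onI])
      (intro continuous_intros)
  have "integrable (lebesgue_on D) (\<lambda>x. (norm (G x $ i))\<^sup>2)"
  proof (rule Bochner_Integration.integrable_bound[OF L2_integrable_norm2[OF G]])
    show "(\<lambda>x. (norm (G x $ i))\<^sup>2) \<in> borel_measurable (lebesgue_on D)"
      using m by measurable
    show "AE x in lebesgue_on D. norm ((norm (G x $ i))\<^sup>2) \<le> norm ((norm (G x))\<^sup>2)"
      using power_mono[OF component_le_norm_cart abs_ge_zero, where n = 2] by (intro AE_I2) simp
  qed
  with m show ?thesis by (simp add: L2_def)
qed

text \<open>The case \<open>c = 0\<close> says that the gradient of a null function vanishes.\<close>

lemma has_H10_grad_unique:
  fixes D :: "(real^'d) set"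
  assumes v: "has_H10_grad D v G" and w: "has_H10_grad D w H" and D: "open D" "bounded D"
    and eq: "AE x in lebesgue_on D. v x = c * w x"
  shows "AE x in lebesgue_on D. G x = c *\<^sub>R H x"
proof -
  have L2: "v \<in> L2 D" "w \<in> L2 D" "G \<in> L2 D" "H \<in> L2 D"
    using v w by (auto simp: has_H10_grad_def)
  \<comment> \<open>Integration by parts moves the claim onto \<open>v x - c * w x\<close>, which is
    null; so each component of the difference is orthogonal to every polynomial.\<close>
  have "AE x in lebesgue_on D. G x $ i - c * H x $ i = 0" for i
  proof (rule L2_orthogonal_polynomials_eq_0[OF _ D])
    show mem: "(\<lambda>x. G x $ i - c * H x $ i) \<in> L2 D"
      using L2_diff[OF L2_nth[OF L2(3)] L2_cmult[OF L2_nth[OF L2(4)]]] by simp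
    fix q :: "real^'d \<Rightarrow> real" assume q: "real_polynomial_function q"
    then obtain q' where q': "real_polynomial_function q'"
      "\<And>x. ((\<lambda>s. q (x + s *\<^sub>R axis i 1)) has_real_derivative q' x) (at 0)"
      using real_polynomial_function_line_derivative by blast
    note qL2 = L2_continuous[OF continuous_on_real_polynomial_function[OF q] D]
      L2_continuous[OF continuous_on_real_polynomial_function[OF q'(1)] D]
    have int: "integrable (lebesgue_on D) (\<lambda>x. G x $ i * q x)"
       "integrable (lebesgue_on D) (\<lambda>x. H x $ i * q x)"
      using L2_integrable_inner[OF L2_nth[OF L2(3)] qL2(1)]
        L2_integrable_inner[OF L2_nth[OF L2(4)] qL2(1)] by simp_all
    have "L2_inner D (\<lambda>x. G x $ i - c * H x $ i) q
        = L2_inner D (\<lambda>x. G x $ i) q - c * L2_inner D (\<lambda>x. H x $ i) q"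
      using int by (simp add: L2_inner_def left_diff_distrib mult.assoc)
    also have "\<dots> = - L2_inner D v q' + c * L2_inner D w q'"
      by (simp add: has_H10_grad_integral_by_parts[OF v D q q']
          has_H10_grad_integral_by_parts[OF w D q q'])
    also have "L2_inner D v q' = (LINT x|lebesgue_on D. c * (w x * q' x))"
      unfolding L2_inner_def inner_real_def
    proof (rule integral_cong_AE)
      show "(\<lambda>x. v x * q' x) \<in> borel_measurable (lebesgue_on D)"
        "(\<lambda>x. c * (w x * q' x)) \<in> borel_measurable (lebesgue_on D)"
        using L2(1,2)[THEN L2_borel] qL2(2)[THEN L2_borel] by measurable
      show "AE x in lebesgue_on D. v x * q' x = c * (w x * q' x)"
        using eq by eventually_elim simp
    qed
    also have "\<dots> = c * L2_inner D w q'"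
      by (simp add: L2_inner_def)
    finally show "L2_inner D (\<lambda>x. G x $ i - c * H x $ i) q = 0" by simp
  qed
  then have "AE x in lebesgue_on D. \<forall>i. G x $ i - c * H x $ i = 0"
    by (subst AE_all_countable) auto
  then show ?thesis
    by eventually_elim (simp add: vec_eq_iff)
qed

section \<open>The dual norm\<close>

lemma has_H10_grad_grad: "v \<in> H10 D \<Longrightarrow> has_H10_grad D v (grad D v)"
  unfolding grad_def H10_def by (drule CollectD) (rule someI_ex[of "has_H10_grad D v"])

lemma H10_imp_L2: "v \<in> H10 D \<Longrightarrow> v \<in> L2 D"
  using has_H10_grad_grad by (auto simp: has_H10_grad_def)

lemma grad_in_L2: "v \<in> H10 D \<Longrightarrow> grad D v \<in> L2 D"
  using has_H10_grad_grad by (auto simp: has_H10_grad_def)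

lemma Ck_uminus: "Ck k \<phi> \<Longrightarrow> Ck k (\<lambda>x. - \<phi> x)"
proof (induction k arbitrary: \<phi>)
  case 0
  then show ?case by (auto intro: continuous_intros)
next
  case (Suc k)
  then obtain g where g: "\<And>x. (\<phi> has_derivative (\<lambda>y. \<Sum>i\<in>UNIV. g i x * y $ i)) (at x)"
    "\<And>i. Ck k (g i)" by auto
  have "((\<lambda>x. - \<phi> x) has_derivative (\<lambda>y. \<Sum>i\<in>UNIV. - g i x * y $ i)) (at x)" for x
    using has_derivative_minus[OF g(1)[of x]] by (simp add: sum_negf)
  moreover have "Ck k (\<lambda>x. - g i x)" for i using Suc.IH g(2) by blast
  ultimately show ?case by (auto intro!: exI[of _ "\<lambda>i x. - g i x"])
qed

lemma test_functions_uminus: "\<phi> \<in> test_functions D \<Longrightarrow> (\<lambda>x. - \<phi> x) \<in> test_functions D"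
  by (auto simp: test_functions_def intro: Ck_uminus)

lemma classical_grad_uminus:
  assumes "\<phi> \<in> test_functions D"
  shows "classical_grad (\<lambda>x. - \<phi> x) x = - classical_grad \<phi> x"
proof -
  note d = test_function_has_derivative(1)[OF assms, of x]
  have "classical_grad (\<lambda>x. - \<phi> x) x $ i = - classical_grad \<phi> x $ i" for i
  proof -
    have "classical_grad (\<lambda>x. - \<phi> x) x $ i
        = frechet_derivative (\<lambda>x. - \<phi> x) (at x) (axis i 1)"
      by (simp add: classical_grad_def)
    also have "\<dots> = - (\<Sum>k\<in>UNIV. classical_grad \<phi> x $ k * axis i 1 $ k)"
      by (simp only: frechet_derivative_at[OF has_derivative_minus[OF d], symmetric])
    finally show ?thesis
      by (simp add: axis_def if_distrib cong: if_cong)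
  qed
  then show ?thesis by (simp add: vec_eq_iff)
qed

lemma has_H10_grad_uminus:
  assumes "has_H10_grad D v G"
  shows "has_H10_grad D (\<lambda>x. - v x) (\<lambda>x. - G x)"
proof -
  obtain \<phi> where \<phi>: "\<And>k. \<phi> k \<in> test_functions D"
    and lim: "(\<lambda>k. L2_norm D (\<lambda>x. \<phi> k x - v x)) \<longlonglongrightarrow> 0"
      "(\<lambda>k. L2_norm D (\<lambda>x. classical_grad (\<phi> k) x - G x)) \<longlonglongrightarrow> 0"
    and L2: "v \<in> L2 D" "G \<in> L2 D"
    using assms unfolding has_H10_grad_def by blast
  have "L2_norm D (\<lambda>x. - \<phi> k x - - v x) = L2_norm D (\<lambda>x. \<phi> k x - v x)" for k
    using L2_norm_uminus[of D "\<lambda>x. \<phi> k x - v x"] by simp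
  moreover have "L2_norm D (\<lambda>x. classical_grad (\<lambda>x. - \<phi> k x) x - - G x)
      = L2_norm D (\<lambda>x. classical_grad (\<phi> k) x - G x)" for k
    using L2_norm_uminus[of D "\<lambda>x. classical_grad (\<phi> k) x - G x"]
    by (simp add: classical_grad_uminus[OF \<phi>])
  ultimately show ?thesis
    unfolding has_H10_grad_def using L2 lim \<phi>
    by (intro conjI exI[of _ "\<lambda>k x. - \<phi> k x"]) (auto intro: L2_uminus test_functions_uminus)
qed

lemma H10_uminus: "v \<in> H10 D \<Longrightarrow> (\<lambda>x. - v x) \<in> H10 D"
  by (auto simp: H10_def dest: has_H10_grad_uminus)

text \<open>\<open>grad\<close> is chosen by \<open>SOME\<close> for each function separately, so
  the choices for \<open>v\<close> and its negative are opposite only almost everywhere, by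
  uniqueness of weak gradients.\<close>

lemma L2_norm_grad_uminus:
  assumes "v \<in> H10 D" "open D" "bounded D"
  shows "L2_norm D (grad D (\<lambda>x. - v x)) = L2_norm D (grad D v)"
proof -
  have "AE x in lebesgue_on D. grad D (\<lambda>x. - v x) x = 1 *\<^sub>R - grad D v x"
    using assms has_H10_grad_grad[OF H10_uminus] has_H10_grad_uminus[OF has_H10_grad_grad]
    by (intro has_H10_grad_unique) auto
  then have "L2_norm D (grad D (\<lambda>x. - v x)) = L2_norm D (\<lambda>x. - grad D v x)"
    using assms by (intro L2_norm_cong_AE grad_in_L2 H10_uminus L2_uminus) auto
  then show ?thesis by (simp add: L2_norm_uminus)
qed

text \<open>Uniqueness of weak gradients with factor \<open>0\<close>. It reconciles the two norms
  in \<open>Hm1_norm\<close>, where functions are excluded by their L2 norm but quotients are taken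
  by the gradient norm.\<close>

lemma L2_norm_grad_eq_0:
  assumes "v \<in> H10 D" "open D" "bounded D" "L2_norm D v = 0"
  shows "L2_norm D (grad D v) = 0"
proof -
  have "AE x in lebesgue_on D. v x = 0 * v x"
    using assms L2_norm_eq_0_iff[OF H10_imp_L2[OF assms(1)]] by simp
  then have "AE x in lebesgue_on D. grad D v x = 0 *\<^sub>R grad D v x"
    using assms has_H10_grad_grad by (intro has_H10_grad_unique) auto
  then show ?thesis
    using L2_norm_eq_0_iff[OF grad_in_L2[OF assms(1)]] by simp
qed

section \<open>Seminorm properties of the dual norm\<close>

lemma Hm1_bdd_above:
  assumes "F \<in> Hm1 D"
  shows "bdd_above ((\<lambda>v. F v / L2_norm D (grad D v)) ` {v \<in> H10 D. L2_norm D v \<noteq> 0})"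
proof -
  obtain K where K: "\<And>v. v \<in> H10 D \<Longrightarrow> \<bar>F v\<bar> \<le> K * L2_norm D (grad D v)"
    using assms unfolding Hm1_def by blast
  \<comment> \<open>A vanishing gradient norm makes the quotient \<open>0\<close> by the convention
    for division, so \<open>\<bar>K\<bar>\<close> bounds it then too.\<close>
  have "F v / L2_norm D (grad D v) \<le> \<bar>K\<bar>" if "v \<in> H10 D" for v
  proof (cases "L2_norm D (grad D v) = 0")
    case False
    then have "0 < L2_norm D (grad D v)" by (simp add: order.not_eq_order_implies_strict)
    moreover have "F v \<le> \<bar>K\<bar> * L2_norm D (grad D v)"
      using K[OF that] mult_right_mono[OF abs_ge_self[of K] L2_norm_nonneg[of D "grad D v"]] by simp
    ultimately show ?thesis by (simp add: divide_le_eq)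
  qed simp
  then show ?thesis by (intro bdd_aboveI[of _ "\<bar>K\<bar>"]) auto
qed

text \<open>If the gradient norm vanishes, boundedness of \<open>F\<close> forces
  \<open>F v = 0\<close>; otherwise \<open>v\<close> is not null and competes in the
  supremum.\<close>

lemma Hm1_le:
  assumes F: "F \<in> Hm1 D" and v: "v \<in> H10 D" and D: "open D" "bounded D"
  shows "F v \<le> Hm1_norm D F * L2_norm D (grad D v)"
proof (cases "L2_norm D (grad D v) = 0")
  case True
  then show ?thesis using F v by (force simp: Hm1_def)
next
  case False
  then have pos: "0 < L2_norm D (grad D v)" by (simp add: order.not_eq_order_implies_strict)
  have "L2_norm D v \<noteq> 0" using False L2_norm_grad_eq_0[OF v D] by blast
  then have "F v / L2_norm D (grad D v) \<le> Hm1_norm D F"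
    unfolding Hm1_norm_def using v by (intro cSUP_upper Hm1_bdd_above[OF F]) auto
  then show ?thesis using pos by (simp add: divide_le_eq)
qed

lemma Hm1_diff:
  assumes "F \<in> Hm1 D" "G \<in> Hm1 D"
  shows "F - G \<in> Hm1 D"
proof -
  obtain K L where "\<And>v. v \<in> H10 D \<Longrightarrow> \<bar>F v\<bar> \<le> K * L2_norm D (grad D v)"
    "\<And>v. v \<in> H10 D \<Longrightarrow> \<bar>G v\<bar> \<le> L * L2_norm D (grad D v)"
    using assms unfolding Hm1_def by blast
  then have "\<bar>F v - G v\<bar> \<le> (K + L) * L2_norm D (grad D v)" if "v \<in> H10 D" for v
    using that by (auto simp: distrib_right intro!: order_trans[OF abs_triangle_ineq4] add_mono)
  then have "\<exists>K. \<forall>v\<in>H10 D. \<bar>(F - G) v\<bar> \<le> K * L2_norm D (grad D v)"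
    by auto
  moreover have "(F - G) (\<lambda>x. v x + w x) = (F - G) v + (F - G) w" if "v \<in> H10 D" "w \<in> H10 D" for v w
    using assms that by (simp add: Hm1_def)
  moreover have "(F - G) (\<lambda>x. c * v x) = c * (F - G) v" if "v \<in> H10 D" for c v
    using assms that by (simp add: Hm1_def right_diff_distrib)
  ultimately show ?thesis unfolding Hm1_def by blast
qed

text \<open>Each quotient of \<open>F\<close> splits into those of \<open>F - G\<close> and
  \<open>G\<close>. Nonemptiness is assumed because the supremum of an empty set of reals carries no
  information.\<close>

lemma Hm1_norm_triangle:
  assumes F: "F \<in> Hm1 D" and G: "G \<in> Hm1 D" and ne: "{v \<in> H10 D. L2_norm D v \<noteq> 0} \<noteq> {}"
  shows "Hm1_norm D F \<le> Hm1_norm D (F - G) + Hm1_norm D G"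
  unfolding Hm1_norm_def[of D F]
proof (rule cSUP_least[OF ne])
  fix v assume v: "v \<in> {v \<in> H10 D. L2_norm D v \<noteq> 0}"
  have "(F - G) v / L2_norm D (grad D v) \<le> Hm1_norm D (F - G)"
    "G v / L2_norm D (grad D v) \<le> Hm1_norm D G"
    unfolding Hm1_norm_def
    by (rule cSUP_upper[OF v Hm1_bdd_above], intro Hm1_diff F G)+
  then show "F v / L2_norm D (grad D v) \<le> Hm1_norm D (F - G) + Hm1_norm D G"
    by (simp add: diff_divide_distrib)
qed

text \<open>Replacing \<open>v\<close> by its negative flips the sign of the numerator and keeps the
  denominator.\<close>

lemma Hm1_norm_minus_le:
  assumes F: "F \<in> Hm1 D" and G: "G \<in> Hm1 D" and ne: "{v \<in> H10 D. L2_norm D v \<noteq> 0} \<noteq> {}"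
    and D: "open D" "bounded D"
  shows "Hm1_norm D (F - G) \<le> Hm1_norm D (G - F)"
  unfolding Hm1_norm_def[of D "F - G"]
proof (rule cSUP_least[OF ne])
  fix v assume v: "v \<in> {v \<in> H10 D. L2_norm D v \<noteq> 0}"
  have neg: "H (\<lambda>x. - v x) = - H v" if "H \<in> Hm1 D" for H
  proof -
    have "H (\<lambda>x. (-1) * v x) = (-1) * H v" using that v unfolding Hm1_def by blast
    then show ?thesis by simp
  qed
  have "(F - G) v / L2_norm D (grad D v)
      = (G - F) (\<lambda>x. - v x) / L2_norm D (grad D (\<lambda>x. - v x))"
    using v D by (simp add: L2_norm_grad_uminus neg[OF F] neg[OF G])
  also have "\<dots> \<le> Hm1_norm D (G - F)"
    unfolding Hm1_norm_def using v
    by (intro cSUP_upper Hm1_bdd_above Hm1_diff F G) (auto intro: H10_uminus simp: L2_norm_uminus)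
  finally show "(F - G) v / L2_norm D (grad D v) \<le> Hm1_norm D (G - F)" .
qed

text \<open>The norm of a simple function is simple, and the reverse triangle inequality makes the
  norms of the simple approximants converge almost everywhere to the norm of
  \<open>f\<close>.\<close>

lemma strongly_measurable_Hm1_norm:
  assumes f: "strongly_measurable M (Hm1 D) (Hm1_norm D) f" and D: "open D" "bounded D"
  shows "\<exists>h\<in>borel_measurable M. AE z in M. Hm1_norm D (f z) = h z"
proof (cases "{v \<in> H10 D. L2_norm D v \<noteq> 0} = {}")
  \<comment> \<open>If all functions in \<open>H10 D\<close> are null, the norm is the constant
    \<open>Sup {}\<close>, hence measurable.\<close>
  case True
  then have "Hm1_norm D F = Sup {}" for F
    by (simp add: Hm1_norm_def del: Collect_empty_eq)
  then show ?thesis by (intro bexI[of _ "\<lambda>_. Sup {}"]) auto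
next
  case ne: False
  obtain s where s: "\<And>k. simple_function M (s k)" "\<And>k. s k ` space M \<subseteq> Hm1 D"
    and lim: "AE z in M. (\<lambda>k. Hm1_norm D (s k z - f z)) \<longlonglongrightarrow> 0"
    and fin: "AE z in M. f z \<in> Hm1 D"
    using f unfolding strongly_measurable_def by blast
  have meas: "(\<lambda>z. Hm1_norm D (s k z)) \<in> borel_measurable M" for k
    using borel_measurable_simple_function[OF simple_function_compose1[OF s(1)[of k], of "Hm1_norm D"]] by simp
  have "AE z in M. Hm1_norm D (f z) = lim (\<lambda>k. Hm1_norm D (s k z))"
    using lim fin AE_space
  proof eventually_elim
    case (elim z)
    have sk: "s k z \<in> Hm1 D" for k using s(2)[of k] elim(3) by auto
    have "(\<lambda>k. Hm1_norm D (s k z) - Hm1_norm D (f z)) \<longlonglongrightarrow> 0"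
    proof (rule Lim_null_comparison[OF always_eventually elim(1)], intro allI)
      fix k
      \<comment> \<open>Convergence is given for \<open>s k z - f z\<close> only; symmetry controls
        the opposite difference.\<close>
      have "Hm1_norm D (f z - s k z) \<le> Hm1_norm D (s k z - f z)"
        by (rule Hm1_norm_minus_le[OF elim(2) sk ne D])
      then show "norm (Hm1_norm D (s k z) - Hm1_norm D (f z)) \<le> Hm1_norm D (s k z - f z)"
        using Hm1_norm_triangle[OF sk elim(2) ne, of k] Hm1_norm_triangle[OF elim(2) sk ne, of k]
        by auto
    qed
    then have "(\<lambda>k. Hm1_norm D (s k z)) \<longlonglongrightarrow> Hm1_norm D (f z)"
      by (simp add: LIM_zero_iff)
    then show ?case by (simp add: limI)
  qed
  then show ?thesis
    using meas by (intro bexI[of _ "\<lambda>z. lim (\<lambda>k. Hm1_norm D (s k z))"]) (auto intro: borel_measurable_lim_metric)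
qed

section \<open>Lower integrals\<close>

text \<open>The integral \<open>nn_integral\<close> of a function that need not be measurable is a lower integral;
  it is superadditive, and additive as soon as one summand is measurable.\<close>

lemma nn_integral_measurable_minorant:
  "\<exists>g\<in>borel_measurable M. g \<le> f \<and> integral\<^sup>N M g = integral\<^sup>N M f"
proof -
  let ?A = "{g. simple_function M g \<and> g \<le> f}"
  have "(\<lambda>_. 0) \<in> ?A" by (auto simp: le_fun_def)
  then have "integral\<^sup>S M ` ?A \<noteq> {}" by blast
  \<comment> \<open>The lower integral is a supremum of integrals of simple minorants. Countably
    many of them reach it, so their pointwise supremum is measurable and has the full
    integral.\<close>
  then obtain c :: "nat \<Rightarrow> ennreal" where c: "range c \<subseteq> integral\<^sup>S M ` ?A" "integral\<^sup>N M f = (SUP i. c i)"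
    unfolding nn_integral_def using ennreal_Sup_countable_SUP[of "integral\<^sup>S M ` ?A"] by auto
  then have "\<forall>i. \<exists>g\<in>?A. c i = integral\<^sup>S M g" by blast
  then obtain g where g: "\<And>i. simple_function M (g i)" "\<And>i. g i \<le> f" "\<And>i. c i = integral\<^sup>S M (g i)"
    by (auto simp: Bex_def dest!: choice)
  define h where "h x = (SUP i. g i x)" for x
  have h: "h \<in> borel_measurable M"
    unfolding h_def using g(1) by (intro borel_measurable_SUP borel_measurable_simple_function) auto
  have le: "h \<le> f"
    using g(2) by (auto simp: h_def le_fun_def intro: SUP_least)
  have "c i \<le> integral\<^sup>N M h" for i
  proof -
    have "c i = integral\<^sup>N M (g i)" by (simp add: g nn_integral_eq_simple_integral)
    also have "\<dots> \<le> integral\<^sup>N M h"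
      by (intro nn_integral_mono) (auto simp: h_def intro: SUP_upper)
    finally show ?thesis .
  qed
  then have "integral\<^sup>N M f \<le> integral\<^sup>N M h" by (simp add: c(2) SUP_least)
  moreover have "integral\<^sup>N M h \<le> integral\<^sup>N M f"
    using le by (intro nn_integral_mono) (auto simp: le_fun_def)
  ultimately show ?thesis using h le by (intro bexI[of _ h]) auto
qed

text \<open>Measurable minorants with the same integrals reduce this to additivity for measurable
  functions.\<close>

lemma nn_integral_superadditive:
  "integral\<^sup>N M f + integral\<^sup>N M g \<le> (\<integral>\<^sup>+ x. f x + g x \<partial>M)"
proof -
  obtain f' where f': "f' \<in> borel_measurable M" "f' \<le> f" "integral\<^sup>N M f' = integral\<^sup>N M f"
    using nn_integral_measurable_minorant by blast
  obtain g' where g': "g' \<in> borel_measurable M" "g' \<le> g" "integral\<^sup>N M g' = integral\<^sup>N M g"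
    using nn_integral_measurable_minorant by blast
  have "integral\<^sup>N M f + integral\<^sup>N M g = (\<integral>\<^sup>+ x. f' x + g' x \<partial>M)"
    using f' g' by (simp add: nn_integral_add)
  also have "\<dots> \<le> (\<integral>\<^sup>+ x. f x + g x \<partial>M)"
    using f'(2) g'(2) by (intro nn_integral_mono add_mono) (auto simp: le_fun_def)
  finally show ?thesis .
qed

lemma nn_integral_sum_superadditive:
  "finite A \<Longrightarrow> (\<Sum>i\<in>A. integral\<^sup>N M (f i)) \<le> (\<integral>\<^sup>+ x. (\<Sum>i\<in>A. f i x) \<partial>M)"
proof (induction A rule: finite_induct)
  case (insert i A)
  then have "(\<Sum>i\<in>insert i A. integral\<^sup>N M (f i)) \<le> integral\<^sup>N M (f i) + (\<integral>\<^sup>+ x. (\<Sum>i\<in>A. f i x) \<partial>M)"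
    by (simp add: add_left_mono)
  also have "\<dots> \<le> (\<integral>\<^sup>+ x. (\<Sum>i\<in>insert i A. f i x) \<partial>M)"
    using insert.hyps nn_integral_superadditive[of M "f i"] by simp
  finally show ?case .
qed simp

lemma nn_integral_cmult_ge: "c * integral\<^sup>N M f \<le> (\<integral>\<^sup>+ x. c * f x \<partial>M)"
proof -
  obtain f' where f': "f' \<in> borel_measurable M" "f' \<le> f" "integral\<^sup>N M f' = integral\<^sup>N M f"
    using nn_integral_measurable_minorant by blast
  have "c * integral\<^sup>N M f = (\<integral>\<^sup>+ x. c * f' x \<partial>M)"
    using f' by (simp add: nn_integral_cmult)
  also have "\<dots> \<le> (\<integral>\<^sup>+ x. c * f x \<partial>M)"
    using f'(2) by (intro nn_integral_mono mult_left_mono) (auto simp: le_fun_def)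
  finally show ?thesis .
qed

text \<open>A positive real factor is invertible in \<open>ennreal\<close>, so the one-sided
  inequality with factor \<open>1 / c\<close>, applied to \<open>c * f\<close>, gives the
  converse.\<close>

lemma nn_integral_cmult_real:
  assumes "0 < c"
  shows "(\<integral>\<^sup>+ x. ennreal c * f x \<partial>M) = ennreal c * integral\<^sup>N M f"
proof (rule antisym)
  have inv: "ennreal c * (ennreal (1 / c) * y) = y" "ennreal (1 / c) * (ennreal c * y) = y" for y
    using assms by (simp_all add: mult.assoc[symmetric] ennreal_mult[symmetric])
  have "ennreal (1 / c) * (\<integral>\<^sup>+ x. ennreal c * f x \<partial>M) \<le> integral\<^sup>N M f"
    using nn_integral_cmult_ge[of "ennreal (1 / c)" M "\<lambda>x. ennreal c * f x"] by (simp add: inv)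
  then show "(\<integral>\<^sup>+ x. ennreal c * f x \<partial>M) \<le> ennreal c * integral\<^sup>N M f"
    using mult_left_mono[of _ _ "ennreal c"] by (fastforce simp: inv)
qed (rule nn_integral_cmult_ge)

text \<open>Subtracting the measurable \<open>f\<close> from a measurable minorant of
  \<open>f + g\<close> leaves a measurable minorant of \<open>g\<close>.\<close>

lemma nn_integral_subadditive:
  assumes f: "f \<in> borel_measurable M"
  shows "(\<integral>\<^sup>+ x. f x + g x \<partial>M) \<le> integral\<^sup>N M f + integral\<^sup>N M g"
proof -
  obtain h where h: "h \<in> borel_measurable M" "h \<le> (\<lambda>x. f x + g x)"
    "integral\<^sup>N M h = (\<integral>\<^sup>+ x. f x + g x \<partial>M)"
    using nn_integral_measurable_minorant by blast
  \<comment> \<open>Where \<open>f x = top\<close>, \<open>f\<close> alone dominates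
    \<open>h\<close>, while the difference could exceed \<open>g\<close>; the value \<open>0\<close>
    keeps both bounds.\<close>
  define k where "k x = (if f x = top then 0 else h x - f x)" for x
  have "integral\<^sup>N M h \<le> (\<integral>\<^sup>+ x. f x + k x \<partial>M)"
  proof (rule nn_integral_mono)
    show "h x \<le> f x + k x" for x
      using ennreal_minus_le_iff[of "h x" "f x" "h x - f x"] by (auto simp: k_def)
  qed
  moreover have "{x \<in> space M. f x = top} \<in> sets M"
    using f by measurable
  then have "k \<in> borel_measurable M"
    unfolding k_def using f h(1) by (intro measurable_If) auto
  then have "(\<integral>\<^sup>+ x. f x + k x \<partial>M) = integral\<^sup>N M f + integral\<^sup>N M k"
    using f by (intro nn_integral_add) auto
  moreover have "integral\<^sup>N M k \<le> integral\<^sup>N M g"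
    using h(2) by (intro nn_integral_mono) (auto simp: k_def le_fun_def ennreal_minus_le_iff)
  ultimately show ?thesis using h(3) by (metis add_left_mono order_trans)
qed

section \<open>Separability of the finite element space\<close>

lemma finite_multi_indices: "finite {\<alpha> :: 'd::finite \<Rightarrow> nat. (\<Sum>i\<in>UNIV. \<alpha> i) \<le> l}"
proof (rule finite_subset)
  show "{\<alpha> :: 'd \<Rightarrow> nat. (\<Sum>i\<in>UNIV. \<alpha> i) \<le> l} \<subseteq> (UNIV \<rightarrow>\<^sub>E {..l})"
  proof
    fix \<alpha> :: "'d \<Rightarrow> nat" assume "\<alpha> \<in> {\<alpha>. (\<Sum>i\<in>UNIV. \<alpha> i) \<le> l}"
    moreover have "\<alpha> i \<le> (\<Sum>i\<in>UNIV. \<alpha> i)" for i by (rule member_le_sum) auto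
    ultimately show "\<alpha> \<in> UNIV \<rightarrow>\<^sub>E {..l}" by (auto intro: order_trans)
  qed
  show "finite (UNIV \<rightarrow>\<^sub>E {..l} :: ('d \<Rightarrow> nat) set)" by (intro finite_PiE) auto
qed

text \<open>Rational coefficients suffice, because there are finitely many monomials and each is
  bounded on \<open>D\<close>.\<close>

lemma polynomials_upto_separable:
  assumes "bounded (D :: (real^'d) set)"
  shows "\<exists>Q. countable Q \<and> (\<forall>p\<in>polynomials_upto l. \<forall>e>0. \<exists>q\<in>Q. \<forall>x\<in>D. \<bar>p x - q x\<bar> \<le> e)"
proof -
  define A where "A = {\<alpha> :: 'd \<Rightarrow> nat. (\<Sum>i\<in>UNIV. \<alpha> i) \<le> l}"
  define m where "m \<alpha> x = (\<Prod>i\<in>UNIV. x $ i ^ \<alpha> i)" for \<alpha> and x :: "real^'d"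
  \<comment> \<open>Extensional coefficient functions are determined by their values on the finite
    set \<open>A\<close>, which makes \<open>Q\<close> countable.\<close>
  define Q where "Q = (\<lambda>c x. \<Sum>\<alpha>\<in>A. c \<alpha> * m \<alpha> x) ` (A \<rightarrow>\<^sub>E \<rat>)"
  have A: "finite A" unfolding A_def by (rule finite_multi_indices)
  have "\<exists>B\<ge>0. \<forall>x\<in>D. \<bar>m \<alpha> x\<bar> \<le> B" for \<alpha>
  proof -
    have "bounded (m \<alpha> ` closure D)"
      unfolding m_def using assms
      by (intro compact_imp_bounded compact_continuous_image continuous_intros) simp
    then obtain B where "\<And>x. x \<in> closure D \<Longrightarrow> \<bar>m \<alpha> x\<bar> \<le> B" by (auto simp: bounded_iff)
    then show ?thesis
      using closure_subset[of D] by (intro exI[of _ "\<bar>B\<bar>"]) force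
  qed
  then obtain B where B: "\<And>\<alpha>. 0 \<le> B \<alpha>" "\<And>\<alpha> x. x \<in> D \<Longrightarrow> \<bar>m \<alpha> x\<bar> \<le> B \<alpha>"
    by metis
  have "\<exists>q\<in>Q. \<forall>x\<in>D. \<bar>p x - q x\<bar> \<le> e" if p: "p \<in> polynomials_upto l" and e: "0 < e" for p e
  proof -
    obtain c where c: "p = (\<lambda>x. \<Sum>\<alpha>\<in>A. c \<alpha> * m \<alpha> x)"
      using p unfolding polynomials_upto_def A_def m_def by blast
    \<comment> \<open>Each monomial may contribute an error of at most
      \<open>e / (card A + 1)\<close>; the added ones keep the denominators positive.\<close>
    define d where "d \<alpha> = e / ((real (card A) + 1) * (B \<alpha> + 1))" for \<alpha>
    have d: "0 < d \<alpha>" for \<alpha>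
      using e B(1)[of \<alpha>] by (simp add: d_def add_nonneg_pos)
    have "\<exists>r\<in>\<rat>. c \<alpha> - d \<alpha> < r \<and> r < c \<alpha>" for \<alpha>
      using d[of \<alpha>] by (intro Rats_dense_in_real) simp
    then obtain r where r: "\<And>\<alpha>. r \<alpha> \<in> \<rat>" "\<And>\<alpha>. \<bar>c \<alpha> - r \<alpha>\<bar> \<le> d \<alpha>"
      by (metis abs_of_nonneg diff_ge_0_iff_ge less_diff_eq less_eq_real_def add.commute diff_less_eq)
    let ?q = "\<lambda>x. \<Sum>\<alpha>\<in>A. restrict r A \<alpha> * m \<alpha> x"
    have "\<bar>p x - ?q x\<bar> \<le> e" if "x \<in> D" for x
    proof -
      have "\<bar>p x - ?q x\<bar> = \<bar>\<Sum>\<alpha>\<in>A. (c \<alpha> - r \<alpha>) * m \<alpha> x\<bar>"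
        by (simp add: c sum_subtractf[symmetric] left_diff_distrib cong: sum.cong)
      also have "\<dots> \<le> (\<Sum>\<alpha>\<in>A. \<bar>(c \<alpha> - r \<alpha>) * m \<alpha> x\<bar>)"
        by (rule sum_abs)
      also have "\<dots> \<le> (\<Sum>\<alpha>\<in>A. e / (real (card A) + 1))"
      proof (rule sum_mono)
        fix \<alpha>
        have "\<bar>(c \<alpha> - r \<alpha>) * m \<alpha> x\<bar> \<le> d \<alpha> * (B \<alpha> + 1)"
          unfolding abs_mult using r(2)[of \<alpha>] B(1)[of \<alpha>] B(2)[OF that, of \<alpha>] d[of \<alpha>]
          by (intro mult_mono) auto
        also have "\<dots> = e / (real (card A) + 1)"
          using B(1)[of \<alpha>] by (simp add: d_def)
        finally show "\<bar>(c \<alpha> - r \<alpha>) * m \<alpha> x\<bar> \<le> e / (real (card A) + 1)" .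
      qed
      also have "\<dots> \<le> e" using e by (simp add: field_simps)
      finally show ?thesis .
    qed
    moreover have "?q \<in> Q"
      unfolding Q_def using r(1) by (intro imageI) auto
    ultimately show ?thesis by (intro bexI[of _ ?q]) auto
  qed
  moreover have "countable Q"
    unfolding Q_def by (intro countable_image countable_PiE A countable_rat)
  ultimately show ?thesis by blast
qed

text \<open>One polynomial from a countable dense family is taken on each of finitely many elements.
  The resulting approximants may jump across faces, so they need not lie in the finite element
  space.\<close>

lemma fe_space_separable_AE:
  assumes \<T>: "finite \<T>" "\<And>K. K \<in> \<T> \<Longrightarrow> K \<in> sets lebesgue" "D \<subseteq> \<Union>\<T>"
    and D: "bounded D" "D \<in> sets lebesgue"
  shows "\<exists>Q. countable Q \<and>
    (\<forall>v\<in>fe_space D \<T> l. \<forall>e>0. \<exists>q\<in>Q. AE x in lebesgue_on D. \<bar>v x - q x\<bar> \<le> e)"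
proof -
  obtain Q where Q: "countable Q"
    "\<forall>p\<in>polynomials_upto l. \<forall>e>0. \<exists>q\<in>Q. \<forall>x\<in>D. \<bar>p x - q x\<bar> \<le> e"
    using polynomials_upto_separable[OF D(1), of l] by (elim exE conjE)
  \<comment> \<open>Closed simplices can share faces; \<open>k\<close> assigns each point to one
    element. Any choice works, because \<open>v\<close> agrees with the polynomial of
    \<open>K\<close> almost everywhere on every \<open>K\<close>.\<close>
  define k where "k x = (SOME K. K \<in> \<T> \<and> x \<in> K)" for x
  have k: "k x \<in> \<T>" "x \<in> k x" if "x \<in> D" for x
  proof -
    have "\<exists>K. K \<in> \<T> \<and> x \<in> K" using that \<T>(3) by blast
    then have "k x \<in> \<T> \<and> x \<in> k x" unfolding k_def by (rule someI_ex)
    then show "k x \<in> \<T>" "x \<in> k x" by auto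
  qed
  define R where "R = (\<lambda>r x. r (k x) x) ` (\<T> \<rightarrow>\<^sub>E Q)"
  have "\<exists>q\<in>R. AE x in lebesgue_on D. \<bar>v x - q x\<bar> \<le> e" if v: "v \<in> fe_space D \<T> l" and e: "0 < e" for v e
  proof -
    have "\<forall>K\<in>\<T>. \<exists>p\<in>polynomials_upto l. AE x in lebesgue_on K. v x = p x"
      using v by (auto simp: fe_space_def)
    then obtain p where p: "\<And>K. K \<in> \<T> \<Longrightarrow> p K \<in> polynomials_upto l"
      "\<And>K. K \<in> \<T> \<Longrightarrow> AE x in lebesgue_on K. v x = p K x"
      by metis
    have "\<forall>K. \<exists>q. K \<in> \<T> \<longrightarrow> q \<in> Q \<and> (\<forall>x\<in>D. \<bar>p K x - q x\<bar> \<le> e)"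
      using Q(2)[rule_format, OF p(1) e] by blast
    from choice[OF this] obtain r
      where "\<forall>K. K \<in> \<T> \<longrightarrow> r K \<in> Q \<and> (\<forall>x\<in>D. \<bar>p K x - r K x\<bar> \<le> e)" ..
    then have r: "\<And>K. K \<in> \<T> \<Longrightarrow> r K \<in> Q"
      "\<And>K x. K \<in> \<T> \<Longrightarrow> x \<in> D \<Longrightarrow> \<bar>p K x - r K x\<bar> \<le> e"
      by auto
    have "AE x in lebesgue. x \<in> K \<longrightarrow> v x = p K x" if "K \<in> \<T>" for K
      using p(2)[OF that] \<T>(2)[OF that] by (subst (asm) AE_restrict_space_iff) auto
    then have "AE x in lebesgue. \<forall>K\<in>\<T>. x \<in> K \<longrightarrow> v x = p K x"
      using \<T>(1) by (intro AE_finite_allI)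
    then have "AE x in lebesgue. x \<in> D \<longrightarrow> \<bar>v x - restrict r \<T> (k x) x\<bar> \<le> e"
    proof eventually_elim
      case (elim x)
      show ?case
        using k[of x] r(2)[of "k x" x] elim by auto
    qed
    then have "AE x in lebesgue_on D. \<bar>v x - restrict r \<T> (k x) x\<bar> \<le> e"
      using D(2) by (subst AE_restrict_space_iff) auto
    moreover have "(\<lambda>x. restrict r \<T> (k x) x) \<in> R"
      unfolding R_def by (rule image_eqI[of _ _ "restrict r \<T>"]) (use r(1) in auto)
    ultimately show ?thesis by (rule bexI)
  qed
  moreover have "countable R"
    unfolding R_def by (intro countable_image countable_PiE \<T> Q(1))
  ultimately show ?thesis by blast
qed

section \<open>Separability in the L2 norm\<close>

lemma L2_norm_le_of_AE_bound:
  assumes v: "v \<in> L2 D" and fin: "finite_measure (lebesgue_on D)" and c: "0 \<le> c"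
    and le: "AE x in lebesgue_on D. norm (v x) \<le> c"
  shows "L2_norm D v \<le> c * sqrt (measure (lebesgue_on D) (space (lebesgue_on D)))"
proof -
  interpret finite_measure "lebesgue_on D" by fact
  have "(L2_norm D v)\<^sup>2 \<le> (LINT x|lebesgue_on D. c\<^sup>2)"
    unfolding L2_norm_power2
  proof (rule integral_mono_AE)
    show "AE x in lebesgue_on D. (norm (v x))\<^sup>2 \<le> c\<^sup>2"
      using le by eventually_elim (auto intro: power_mono)
  qed (use L2_integrable_norm2[OF v] in auto)
  also have "\<dots> = (c * sqrt (measure (lebesgue_on D) (space (lebesgue_on D))))\<^sup>2"
    by (simp add: power_mult_distrib)
  finally show ?thesis
    by (rule power2_le_imp_le) (use c in simp)
qed

text \<open>Each approximant that is close to \<open>V\<close> is replaced by a nearby element of \<open>V\<close>.\<close>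

lemma L2_separable_from_AE:
  assumes V: "V \<subseteq> L2 D" and fin: "finite_measure (lebesgue_on D)" and Q: "countable Q"
    and dense: "\<And>v e. v \<in> V \<Longrightarrow> 0 < e \<Longrightarrow> \<exists>q\<in>Q. AE x in lebesgue_on D. norm (v x - q x) \<le> e"
  shows "\<exists>V0\<subseteq>V. countable V0 \<and> (\<forall>v\<in>V. \<forall>e>0. \<exists>w\<in>V0. L2_norm D (\<lambda>x. v x - w x) \<le> e)"
proof -
  define near where "near q n w \<longleftrightarrow> w \<in> V \<and> (AE x in lebesgue_on D. norm (w x - q x) \<le> 1 / real (Suc n))" for q n w
  \<comment> \<open>If no element of \<open>V\<close> is near \<open>q\<close>, \<open>SOME\<close>
    returns an arbitrary function; intersecting with \<open>V\<close> discards choices outside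
    \<open>V\<close>.\<close>
  define V0 where "V0 = (\<lambda>(q, n). SOME w. near q n w) ` (Q \<times> UNIV) \<inter> V"
  define \<mu> where "\<mu> = sqrt (measure (lebesgue_on D) (space (lebesgue_on D)))"
  have \<mu>: "0 \<le> \<mu>" by (simp add: \<mu>_def)
  have "\<exists>w\<in>V0. L2_norm D (\<lambda>x. v x - w x) \<le> e" if v: "v \<in> V" and e: "0 < e" for v e
  proof -
    \<comment> \<open>The factor \<open>2\<close> stems from passing through \<open>q\<close>, which
      is within \<open>1 / Suc n\<close> of both \<open>v\<close> and \<open>w\<close>;
      \<open>\<mu>\<close> turns the uniform bound into an L2 bound.\<close>
    obtain n where "(2 * \<mu> + 1) / e < real n"
      using reals_Archimedean2 by blast
    then have n: "2 / real (Suc n) * \<mu> \<le> e"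
      using e \<mu> by (simp add: field_simps)
    obtain q where q: "q \<in> Q" "AE x in lebesgue_on D. norm (v x - q x) \<le> 1 / real (Suc n)"
      using dense[OF v, of "1 / real (Suc n)"] by auto
    define w where "w = (SOME w. near q n w)"
    have "near q n v" using v q by (simp add: near_def)
    then have "near q n w" unfolding w_def by (rule someI[of "near q n"])
    then have w: "w \<in> V" "AE x in lebesgue_on D. norm (w x - q x) \<le> 1 / real (Suc n)"
      by (auto simp: near_def)
    have "L2_norm D (\<lambda>x. v x - w x) \<le> 2 / real (Suc n) * \<mu>"
      unfolding \<mu>_def
    proof (rule L2_norm_le_of_AE_bound)
      show "AE x in lebesgue_on D. norm (v x - w x) \<le> 2 / real (Suc n)"
        using q(2) w(2)
      proof eventually_elim
        case (elim x)
        have "norm (v x - w x) \<le> norm (v x - q x) + norm (w x - q x)"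
          using norm_triangle_ineq4[of "v x - q x" "w x - q x"] by simp
        with elim show ?case by simp
      qed
    qed (use V v w fin in \<open>auto intro: L2_diff\<close>)
    with n have "L2_norm D (\<lambda>x. v x - w x) \<le> e" by linarith
    moreover have "w \<in> V0" using w(1) q(1) by (auto simp: V0_def w_def)
    ultimately show ?thesis by blast
  qed
  moreover have "countable V0" using Q by (auto simp: V0_def)
  moreover have "V0 \<subseteq> V" by (auto simp: V0_def)
  ultimately show ?thesis by blast
qed

lemma fe_space_subset_L2: "fe_space D \<T> l \<subseteq> L2 D"
  by (auto simp: fe_space_def H10_def has_H10_grad_def)

lemma fe_space_separable:
  assumes "open D" "bounded D" and \<T>: "quasi_uniform_mesh \<sigma> D \<T>"
  shows "\<exists>V0\<subseteq>fe_space D \<T> l. countable V0 \<and>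
    (\<forall>v\<in>fe_space D \<T> l. \<forall>e>0. \<exists>w\<in>V0. L2_norm D (\<lambda>x. v x - w x) \<le> e)"
proof -
  have "K \<in> sets lebesgue" if "K \<in> \<T>" for K
    using \<T> that by (intro lmeasurable_compact[THEN fmeasurableD] compact_simplex)
      (auto simp: quasi_uniform_mesh_def)
  moreover have "finite \<T>" "D \<subseteq> \<Union>\<T>"
    using \<T> closure_subset[of D] by (auto simp: quasi_uniform_mesh_def triangulation_def)
  ultimately obtain Q where Q: "countable Q"
    "\<forall>v\<in>fe_space D \<T> l. \<forall>e>0. \<exists>q\<in>Q. AE x in lebesgue_on D. \<bar>v x - q x\<bar> \<le> e"
    using fe_space_separable_AE[of \<T> D l] assms(1,2) by (auto simp: bounded_set_imp_lmeasurable)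
  show ?thesis
    by (rule L2_separable_from_AE[OF fe_space_subset_L2 finite_measure_lebesgue_on_bounded[OF assms(1,2)] Q(1)])
      (use Q(2) in simp)
qed

section \<open>Measurability of the projected initial value\<close>

lemma ennreal_add_le: "0 \<le> e \<Longrightarrow> ennreal (a + e) \<le> ennreal a + ennreal e"
  by (cases "0 \<le> a") (auto simp: ennreal_neg intro: ennreal_leI)

text \<open>Completing the square turns the real expression on the right into
  \<open>(L2_norm D P)^2\<close> minus the squared distance from \<open>P\<close> to
  \<open>v\<close>. It is largest at \<open>v = P\<close>, and density lets \<open>V0\<close>
  approach this value.\<close>

lemma L2_projection_norm_SUP:
  assumes V: "V \<subseteq> L2 D" and V0: "V0 \<subseteq> V"
    and dense: "\<And>v e. v \<in> V \<Longrightarrow> 0 < e \<Longrightarrow> \<exists>w\<in>V0. L2_norm D (\<lambda>x. v x - w x) \<le> e"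
    and P: "P \<in> V" and proj: "\<And>v. v \<in> V \<Longrightarrow> L2_inner D P v = L2_inner D g v"
  shows "ennreal ((L2_norm D P)\<^sup>2) = (SUP v\<in>V0. ennreal (2 * L2_inner D g v - (L2_norm D v)\<^sup>2))"
proof (rule antisym)
  have eq: "2 * L2_inner D g v - (L2_norm D v)\<^sup>2
      = (L2_norm D P)\<^sup>2 - (L2_norm D (\<lambda>x. P x - v x))\<^sup>2" if "v \<in> V" for v
    using L2_norm_diff_power2[of P D v] V P that by (simp add: proj[symmetric] subset_iff)
  then show "(SUP v\<in>V0. ennreal (2 * L2_inner D g v - (L2_norm D v)\<^sup>2)) \<le> ennreal ((L2_norm D P)\<^sup>2)"
    using V0 by (intro SUP_least ennreal_leI) auto
  show "ennreal ((L2_norm D P)\<^sup>2) \<le> (SUP v\<in>V0. ennreal (2 * L2_inner D g v - (L2_norm D v)\<^sup>2))"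
  proof (rule ennreal_le_epsilon)
    fix e :: real assume "0 < e"
    then obtain w where w: "w \<in> V0" "L2_norm D (\<lambda>x. P x - w x) \<le> sqrt e"
      using dense[OF P, of "sqrt e"] by auto
    have "(L2_norm D (\<lambda>x. P x - w x))\<^sup>2 \<le> e"
      using power_mono[OF w(2), of 2] \<open>0 < e\<close> by simp
    then have "ennreal ((L2_norm D P)\<^sup>2) \<le> ennreal ((2 * L2_inner D g w - (L2_norm D w)\<^sup>2) + e)"
      using eq[of w] w(1) V0 by (intro ennreal_leI) auto
    \<comment> \<open>Since \<open>ennreal\<close> truncates negative numbers to \<open>0\<close>,
      splitting off \<open>e\<close> yields only an inequality.\<close>
    also have "\<dots> \<le> ennreal (2 * L2_inner D g w - (L2_norm D w)\<^sup>2) + ennreal e"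
      using \<open>0 < e\<close> by (intro ennreal_add_le) simp
    also have "\<dots> \<le> (SUP v\<in>V0. ennreal (2 * L2_inner D g v - (L2_norm D v)\<^sup>2)) + ennreal e"
      using w(1) by (intro add_right_mono SUP_upper)
    finally show "ennreal ((L2_norm D P)\<^sup>2)
      \<le> (SUP v\<in>V0. ennreal (2 * L2_inner D g v - (L2_norm D v)\<^sup>2)) + ennreal e" .
  qed
qed

lemma borel_measurable_L2_inner:
  fixes g :: "'w \<Rightarrow> (real^'d) \<Rightarrow> real"
  assumes g: "(\<lambda>(\<omega>, x). g \<omega> x) \<in> borel_measurable (M \<Otimes>\<^sub>M lebesgue_on D)" and v: "v \<in> L2 D"
    and fin: "finite_measure (lebesgue_on D)"
  shows "(\<lambda>\<omega>. L2_inner D (g \<omega>) v) \<in> borel_measurable M"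
proof -
  interpret finite_measure "lebesgue_on D" by fact
  have "(\<lambda>z. v (snd z)) \<in> borel_measurable (M \<Otimes>\<^sub>M lebesgue_on D)"
    using L2_borel[OF v] by measurable
  then have "(\<lambda>(\<omega>, x). g \<omega> x * v x) \<in> borel_measurable (M \<Otimes>\<^sub>M lebesgue_on D)"
    using g by (simp add: case_prod_beta')
  then show ?thesis
    unfolding L2_inner_def inner_real_def by (rule borel_measurable_lebesgue_integral)
qed

section \<open>The energy estimate\<close>

lemma AE_Linf_norm_le:
  assumes "Linf_norm D v \<le> ereal c"
  shows "AE x in lebesgue_on D. \<bar>v x\<bar> \<le> c"
proof -
  have "AE x in lebesgue_on D. ereal \<bar>v x\<bar> \<le> Linf_norm D v"
    unfolding Linf_norm_def by (rule esssup_AE)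
  then show ?thesis
  proof eventually_elim
    case (elim x)
    then have "ereal \<bar>v x\<bar> \<le> ereal c" using assms by (rule order_trans)
    then show ?case by simp
  qed
qed

lemma Linf_AE_bounded:
  assumes "v \<in> Linf D"
  shows "\<exists>K. AE x in lebesgue_on D. \<bar>v x\<bar> \<le> K"
proof (cases "Linf_norm D v")
  case (real r)
  then show ?thesis using AE_Linf_norm_le[of D v r] by auto
next
  case PInf
  then show ?thesis using assms by (simp add: Linf_def)
next
  \<comment> \<open>\<open>-\<infinity>\<close> lies below every real number, so \<open>0\<close>
    may serve as the bound.\<close>
  case MInf
  then show ?thesis using AE_Linf_norm_le[of D v 0] by auto
qed

section \<open>Bounds for the ensemble mean\<close>

lemma ensemble_mean_borel:
  "(\<And>i. i \<in> {1..J} \<Longrightarrow> a i \<in> borel_measurable M) \<Longrightarrow> ensemble_mean J a \<in> borel_measurable M"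
  unfolding ensemble_mean_def[abs_def] by (intro borel_measurable_divide borel_measurable_sum) auto

text \<open>Only finiteness of the bound matters: it makes the implicit diffusion term integrable,
  and its value never enters the energy estimate.\<close>

lemma ensemble_mean_AE_bounded:
  assumes "\<And>i. i \<in> {1..J} \<Longrightarrow> a i \<in> Linf D"
  shows "\<exists>K. AE x in lebesgue_on D. \<bar>ensemble_mean J a x\<bar> \<le> K"
proof -
  obtain K where "\<And>i. i \<in> {1..J} \<Longrightarrow> AE x in lebesgue_on D. \<bar>a i x\<bar> \<le> K i"
    using Linf_AE_bounded[OF assms] by metis
  then have "AE x in lebesgue_on D. \<forall>i\<in>{1..J}. \<bar>a i x\<bar> \<le> K i"
    by (intro AE_finite_allI) auto
  then have "AE x in lebesgue_on D. \<bar>ensemble_mean J a x\<bar> \<le> (\<Sum>i=1..J. K i) / real J"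
  proof eventually_elim
    case (elim x)
    have "\<bar>\<Sum>i=1..J. a i x\<bar> \<le> (\<Sum>i=1..J. \<bar>a i x\<bar>)" by (rule sum_abs)
    also have "\<dots> \<le> (\<Sum>i=1..J. K i)" using elim by (intro sum_mono) auto
    finally show ?case by (simp add: ensemble_mean_def divide_right_mono)
  qed
  then show ?thesis by blast
qed

lemma ensemble_mean_ge:
  assumes "1 \<le> J" "\<And>i. i \<in> {1..J} \<Longrightarrow> \<theta> \<le> a i x"
  shows "\<theta> \<le> ensemble_mean J a x"
proof -
  have "real J * \<theta> \<le> (\<Sum>i=1..J. a i x)"
    using sum_mono[of "{1..J}" "\<lambda>_. \<theta>" "\<lambda>i. a i x"] assms(2) by simp
  then show ?thesis
    using assms(1) by (simp add: ensemble_mean_def field_simps)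
qed

text \<open>Coercivity of the implicit diffusion term.\<close>

lemma L2_inner_scaleR_ge:
  assumes b: "b \<in> borel_measurable (lebesgue_on D)" "AE x in lebesgue_on D. \<bar>b x\<bar> \<le> K"
    and ge: "AE x in lebesgue_on D. \<theta> \<le> b x" and G: "G \<in> L2 D"
  shows "\<theta> * (L2_norm D G)\<^sup>2 \<le> L2_inner D (\<lambda>x. b x *\<^sub>R G x) G"
proof -
  have "\<theta> * (L2_norm D G)\<^sup>2 = (LINT x|lebesgue_on D. \<theta> * (norm (G x))\<^sup>2)"
    by (simp add: L2_norm_power2)
  also have "\<dots> \<le> L2_inner D (\<lambda>x. b x *\<^sub>R G x) G"
    unfolding L2_inner_def
  proof (rule integral_mono_AE)
    show "integrable (lebesgue_on D) (\<lambda>x. \<theta> * (norm (G x))\<^sup>2)"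
      using L2_integrable_norm2[OF G] by simp
    show "integrable (lebesgue_on D) (\<lambda>x. (b x *\<^sub>R G x) \<bullet> G x)"
      by (intro L2_integrable_inner L2_scaleR_bounded[OF G b] G)
    show "AE x in lebesgue_on D. \<theta> * (norm (G x))\<^sup>2 \<le> (b x *\<^sub>R G x) \<bullet> G x"
      using ge by eventually_elim (simp add: power2_norm_eq_inner mult_right_mono)
  qed
  finally show ?thesis .
qed

text \<open>Young's inequality charges the explicit fluctuation term in equal shares to the old and
  the new gradient; the old share later telescopes.\<close>

lemma L2_inner_scaleR_le:
  assumes b: "b \<in> borel_measurable (lebesgue_on D)" "AE x in lebesgue_on D. \<bar>b x\<bar> \<le> K"
    and G: "G \<in> L2 D" and H: "H \<in> L2 D"
  shows "2 * \<bar>L2_inner D (\<lambda>x. b x *\<^sub>R G x) H\<bar> \<le> K * ((L2_norm D G)\<^sup>2 + (L2_norm D H)\<^sup>2)"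
proof -
  have int: "integrable (lebesgue_on D) (\<lambda>x. (b x *\<^sub>R G x) \<bullet> H x)"
    by (intro L2_integrable_inner L2_scaleR_bounded[OF G b] H)
  have "2 * \<bar>L2_inner D (\<lambda>x. b x *\<^sub>R G x) H\<bar> \<le> 2 * (LINT x|lebesgue_on D. \<bar>(b x *\<^sub>R G x) \<bullet> H x\<bar>)"
    unfolding L2_inner_def by (intro mult_left_mono integral_abs_bound) simp
  also have "\<dots> = (LINT x|lebesgue_on D. 2 * \<bar>(b x *\<^sub>R G x) \<bullet> H x\<bar>)"
    by simp
  also have "\<dots> \<le> (LINT x|lebesgue_on D. K * ((norm (G x))\<^sup>2 + (norm (H x))\<^sup>2))"
  proof (rule integral_mono_AE)
    show "integrable (lebesgue_on D) (\<lambda>x. 2 * \<bar>(b x *\<^sub>R G x) \<bullet> H x\<bar>)"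
      using int by simp
    show "integrable (lebesgue_on D) (\<lambda>x. K * ((norm (G x))\<^sup>2 + (norm (H x))\<^sup>2))"
      using G[THEN L2_integrable_norm2] H[THEN L2_integrable_norm2] by simp
    show "AE x in lebesgue_on D. 2 * \<bar>(b x *\<^sub>R G x) \<bullet> H x\<bar> \<le> K * ((norm (G x))\<^sup>2 + (norm (H x))\<^sup>2)"
      using b(2)
    proof eventually_elim
      case (elim x)
      have "2 * \<bar>(b x *\<^sub>R G x) \<bullet> H x\<bar> = \<bar>b x\<bar> * (2 * \<bar>G x \<bullet> H x\<bar>)"
        by (simp add: abs_mult)
      also have "\<dots> \<le> K * ((norm (G x))\<^sup>2 + (norm (H x))\<^sup>2)"
        using elim two_inner_le[of "G x" "H x"] by (intro mult_mono) auto
      finally show ?case .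
    qed
  qed
  also have "\<dots> = K * ((L2_norm D G)\<^sup>2 + (L2_norm D H)\<^sup>2)"
    using G[THEN L2_integrable_norm2] H[THEN L2_integrable_norm2] by (simp add: L2_norm_power2)
  finally show ?thesis .
qed

text \<open>After doubling, coercivity supplies \<open>2 * \<theta>\<close> times the squared new
  gradient norm. The fluctuation takes \<open>\<theta>p\<close> and the forcing
  \<open>\<theta> - \<theta>p\<close>, so exactly \<open>\<theta>\<close> remains.\<close>

lemma energy_step:
  assumes D: "open D" "bounded D" and "\<theta>p < \<theta>" and t: "0 < \<Delta>t"
    and u: "u \<in> H10 D" and u': "u' \<in> H10 D" and F: "F \<in> Hm1 D"
    and A: "A \<in> borel_measurable (lebesgue_on D)" "AE x in lebesgue_on D. \<bar>A x\<bar> \<le> K"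
      "AE x in lebesgue_on D. \<theta> \<le> A x"
    and B: "B \<in> borel_measurable (lebesgue_on D)" "AE x in lebesgue_on D. \<bar>B x\<bar> \<le> \<theta>p"
    and eq: "L2_inner D (\<lambda>x. (u' x - u x) / \<Delta>t) u' + L2_inner D (\<lambda>x. A x *\<^sub>R grad D u' x) (grad D u')
      + L2_inner D (\<lambda>x. B x *\<^sub>R grad D u x) (grad D u') = F u'"
  shows "(L2_norm D u')\<^sup>2 + \<Delta>t * \<theta> * (L2_norm D (grad D u'))\<^sup>2
    \<le> (L2_norm D u)\<^sup>2 + \<Delta>t * \<theta>p * (L2_norm D (grad D u))\<^sup>2 + \<Delta>t / (\<theta> - \<theta>p) * (Hm1_norm D F)\<^sup>2"
proof -
  define X where "X = L2_norm D (grad D u')"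
  define N where "N = Hm1_norm D F"
  note L2 = H10_imp_L2[OF u] H10_imp_L2[OF u']
  have "L2_inner D (\<lambda>x. (u' x - u x) / \<Delta>t) u' = ((L2_norm D u')\<^sup>2 - L2_inner D u u') / \<Delta>t"
  proof -
    have "L2_inner D (\<lambda>x. (u' x - u x) / \<Delta>t) u' = (LINT x|lebesgue_on D. (u' x \<bullet> u' x - u x \<bullet> u' x) / \<Delta>t)"
      by (simp add: L2_inner_def algebra_simps)
    also have "\<dots> = ((L2_norm D u')\<^sup>2 - L2_inner D u u') / \<Delta>t"
      using L2_integrable_inner[OF L2(2,2)] L2_integrable_inner[OF L2]
      by (simp add: L2_inner_def flip: L2_inner_self)
    finally show ?thesis .
  qed
  \<comment> \<open>The cross term is split by Young's inequality with weight
    \<open>1\<close>.\<close>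
  then have 1: "2 * \<Delta>t * L2_inner D (\<lambda>x. (u' x - u x) / \<Delta>t) u' \<ge> (L2_norm D u')\<^sup>2 - (L2_norm D u)\<^sup>2"
    using L2_inner_le_weighted[OF L2, of 1] t by auto
  have 2: "\<theta> * X\<^sup>2 \<le> L2_inner D (\<lambda>x. A x *\<^sub>R grad D u' x) (grad D u')"
    unfolding X_def by (rule L2_inner_scaleR_ge[OF A grad_in_L2[OF u']])
  have 3: "2 * L2_inner D (\<lambda>x. B x *\<^sub>R grad D u x) (grad D u') \<ge> - (\<theta>p * ((L2_norm D (grad D u))\<^sup>2 + X\<^sup>2))"
    using L2_inner_scaleR_le[OF B grad_in_L2[OF u] grad_in_L2[OF u']] by (simp add: X_def)
  \<comment> \<open>Young's inequality with weight \<open>\<theta> - \<theta>p\<close>, the part of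
    coercivity left over by the fluctuation; this produces the factor
    \<open>1 / (\<theta> - \<theta>p)\<close>.\<close>
  have 4: "2 * F u' \<le> N\<^sup>2 / (\<theta> - \<theta>p) + (\<theta> - \<theta>p) * X\<^sup>2"
  proof -
    let ?\<delta> = "\<theta> - \<theta>p"
    have "0 \<le> (N - ?\<delta> * X)\<^sup>2 / ?\<delta>" using \<open>\<theta>p < \<theta>\<close> by simp
    also have "\<dots> = N\<^sup>2 / ?\<delta> - 2 * (N * X) + ?\<delta> * X\<^sup>2"
      using \<open>\<theta>p < \<theta>\<close> by (simp add: field_simps power2_eq_square)
    finally show ?thesis
      using Hm1_le[OF F u' D] by (simp add: N_def X_def)
  qed
  have "2 * L2_inner D (\<lambda>x. (u' x - u x) / \<Delta>t) u'
      \<le> \<theta>p * (L2_norm D (grad D u))\<^sup>2 + N\<^sup>2 / (\<theta> - \<theta>p) - \<theta> * X\<^sup>2"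
    using eq 2 3 4 by (simp add: algebra_simps)
  then have "\<Delta>t * (2 * L2_inner D (\<lambda>x. (u' x - u x) / \<Delta>t) u')
      \<le> \<Delta>t * (\<theta>p * (L2_norm D (grad D u))\<^sup>2 + N\<^sup>2 / (\<theta> - \<theta>p) - \<theta> * X\<^sup>2)"
    using t by (intro mult_left_mono) auto
  with 1 show ?thesis
    by (simp add: N_def X_def algebra_simps)
qed

text \<open>Writing \<open>\<theta> = \<theta>p + (\<theta> - \<theta>p)\<close>, the
  \<open>\<theta>p\<close> share of each new gradient cancels against the old gradient of the next
  step, and the rest accumulates in the sum.\<close>

lemma energy_sum:
  fixes U X f :: "nat \<Rightarrow> real"
  assumes "\<And>n. n < N \<Longrightarrow> U (Suc n) + \<Delta>t * \<theta> * X (Suc n) \<le> U n + \<Delta>t * \<theta>p * X n + c * f (Suc n)"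
  shows "U N + \<Delta>t * \<theta>p * X N + \<Delta>t * (\<theta> - \<theta>p) * (\<Sum>n=1..N. X n)
    \<le> U 0 + \<Delta>t * \<theta>p * X 0 + c * (\<Sum>n=1..N. f n)"
  using assms
proof (induction N)
  case (Suc N)
  then have "U N + \<Delta>t * \<theta>p * X N + \<Delta>t * (\<theta> - \<theta>p) * (\<Sum>n=1..N. X n)
    \<le> U 0 + \<Delta>t * \<theta>p * X 0 + c * (\<Sum>n=1..N. f n)" by simp
  then show ?case using Suc.prems[of N] by (simp add: algebra_simps)
qed simp

text \<open>The estimate for one realization. The lower bound is assumed for every member, because
  the implicit coefficient is their mean; the fluctuation bound concerns member \<open>j\<close>
  alone.\<close>

lemma ensemble_scheme_energy:
  assumes D: "open D" "bounded D" and "1 \<le> J" "j \<in> {1..J}" and t: "0 < \<Delta>t" and "\<theta>p < \<theta>"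
    and V: "V \<subseteq> H10 D"
    and a: "\<And>i n. i \<in> {1..J} \<Longrightarrow> n \<in> {1..N} \<Longrightarrow> a i n \<in> Linf D"
      "\<And>i n x. i \<in> {1..J} \<Longrightarrow> n \<in> {1..N} \<Longrightarrow> x \<in> D \<Longrightarrow> \<theta> \<le> a i n x"
      "\<And>n. n \<in> {1..N} \<Longrightarrow> Linf_norm D (\<lambda>x. a j n x - ensemble_mean J (\<lambda>i. a i n) x) \<le> ereal \<theta>p"
    and F: "\<And>n. n \<in> {1..N} \<Longrightarrow> F j n \<in> Hm1 D"
    and scheme: "ensemble_scheme D V J N \<Delta>t a F g u"
  shows "(L2_norm D (u j N))\<^sup>2 + \<Delta>t * \<theta>p * (L2_norm D (grad D (u j N)))\<^sup>2
      + \<Delta>t * (\<theta> - \<theta>p) * (\<Sum>n=1..N. (L2_norm D (grad D (u j n)))\<^sup>2)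
    \<le> (L2_norm D (u j 0))\<^sup>2 + \<Delta>t * \<theta>p * (L2_norm D (grad D (u j 0)))\<^sup>2
      + \<Delta>t / (\<theta> - \<theta>p) * (\<Sum>n=1..N. (Hm1_norm D (F j n))\<^sup>2)"
proof (rule energy_sum)
  fix n assume n: "n < N"
  then have n1: "Suc n \<in> {1..N}" by simp
  have uV: "u j m \<in> V" if "m \<le> N" for m
    using scheme that \<open>j \<in> {1..J}\<close> by (cases m) (auto simp: ensemble_scheme_def)
  let ?A = "ensemble_mean J (\<lambda>i. a i (Suc n))"
  have meas: "a i (Suc n) \<in> borel_measurable (lebesgue_on D)" if "i \<in> {1..J}" for i
    using a(1)[OF that n1] by (simp add: Linf_def)
  obtain K where K: "AE x in lebesgue_on D. \<bar>?A x\<bar> \<le> K"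
    using ensemble_mean_AE_bounded[of J "\<lambda>i. a i (Suc n)"] a(1) n1 by blast
  show "(L2_norm D (u j (Suc n)))\<^sup>2 + \<Delta>t * \<theta> * (L2_norm D (grad D (u j (Suc n))))\<^sup>2
    \<le> (L2_norm D (u j n))\<^sup>2 + \<Delta>t * \<theta>p * (L2_norm D (grad D (u j n)))\<^sup>2
      + \<Delta>t / (\<theta> - \<theta>p) * (Hm1_norm D (F j (Suc n)))\<^sup>2"
  proof (rule energy_step[OF D \<open>\<theta>p < \<theta>\<close> t])
    show "u j n \<in> H10 D" "u j (Suc n) \<in> H10 D" using uV n V by auto
    show "F j (Suc n) \<in> Hm1 D" by (rule F[OF n1])
    show A: "?A \<in> borel_measurable (lebesgue_on D)"
      by (rule ensemble_mean_borel) (rule meas)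
    show "AE x in lebesgue_on D. \<bar>?A x\<bar> \<le> K" by fact
    show "AE x in lebesgue_on D. \<theta> \<le> ?A x"
      using a(2) n1 \<open>1 \<le> J\<close> by (intro AE_I2 ensemble_mean_ge) auto
    show "(\<lambda>x. a j (Suc n) x - ?A x) \<in> borel_measurable (lebesgue_on D)"
      by (intro borel_measurable_diff meas A \<open>j \<in> {1..J}\<close>)
    show "AE x in lebesgue_on D. \<bar>a j (Suc n) x - ?A x\<bar> \<le> \<theta>p"
      by (rule AE_Linf_norm_le[OF a(3)[OF n1]])
    show "L2_inner D (\<lambda>x. (u j (Suc n) x - u j n x) / \<Delta>t) (u j (Suc n))
      + L2_inner D (\<lambda>x. ?A x *\<^sub>R grad D (u j (Suc n)) x) (grad D (u j (Suc n)))
      + L2_inner D (\<lambda>x. (a j (Suc n) x - ?A x) *\<^sub>R grad D (u j n) x) (grad D (u j (Suc n)))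
      = F j (Suc n) (u j (Suc n))"
      using scheme n \<open>j \<in> {1..J}\<close> uV[of "Suc n"] by (simp add: ensemble_scheme_def)
  qed
qed

section \<open>Expectations\<close>

lemma independent_samples_measurable:
  assumes "independent_samples M S J W" "i \<in> {1..J}"
  shows "W i \<in> measurable S M"
proof -
  interpret prob_space S using assms(1) by (simp add: independent_samples_def)
  show ?thesis using assms unfolding independent_samples_def indep_vars_def by blast
qed

text \<open>Each sample has law \<open>M\<close>, so its preimages of null sets are null; this
  transfers almost sure properties of the data to the sample space.\<close>

lemma independent_samples_AE:
  assumes "independent_samples M S J W" "i \<in> {1..J}" "AE \<omega> in M. P \<omega>"
  shows "AE s in S. P (W i s)"
proof (rule AE_distrD[OF independent_samples_measurable[OF assms(1,2)]])
  have "distr S M (W i) = M"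
    using assms(1,2) unfolding independent_samples_def by blast
  then show "AE \<omega> in distr S M (W i). P \<omega>"
    using assms(3) by metis
qed

text \<open>Superadditivity handles the left side. On the right only \<open>X 0\<close> lacks a
  measurable version, and subadditivity tolerates one such summand.\<close>

lemma nn_expectation_energy:
  fixes X :: "nat \<Rightarrow> 's \<Rightarrow> real" and f :: "nat \<Rightarrow> 's \<Rightarrow> real"
  assumes nonneg: "\<And>n s. 0 \<le> X n s" "\<And>s. 0 \<le> Y s" "\<And>s. 0 \<le> Z s" "0 \<le> \<alpha>" "0 \<le> \<beta>" "0 < \<gamma>"
    and f: "\<And>n. n \<in> {1..N} \<Longrightarrow> \<exists>h\<in>borel_measurable S. AE s in S. f n s = h s"
    and Z: "\<exists>h\<in>borel_measurable S. AE s in S. ennreal (Z s) = h s"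
    and le: "AE s in S. Y s + \<alpha> * X N s + \<beta> * (\<Sum>n=1..N. X n s)
      \<le> \<gamma> * (\<Sum>n=1..N. (f n s)\<^sup>2) + \<gamma> * X 0 s + Z s"
  shows "nn_expectation S Y + ennreal \<alpha> * nn_expectation S (X N)
      + ennreal \<beta> * (\<Sum>n=1..N. nn_expectation S (X n))
    \<le> ennreal \<gamma> * (\<Sum>n=1..N. nn_expectation S (\<lambda>s. (f n s)\<^sup>2))
      + ennreal \<gamma> * nn_expectation S (X 0) + nn_expectation S Z"
proof -
  obtain h where h: "\<And>n. n \<in> {1..N} \<Longrightarrow> h n \<in> borel_measurable S"
    "\<And>n. n \<in> {1..N} \<Longrightarrow> AE s in S. f n s = h n s"
    using f by metis
  obtain z where z: "z \<in> borel_measurable S" "AE s in S. ennreal (Z s) = z s"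
    using Z by blast
  \<comment> \<open>\<open>R\<close> collects the measurable versions of all right-hand terms except
    the one with \<open>X 0\<close>.\<close>
  define R where "R s = ennreal \<gamma> * (\<Sum>n=1..N. ennreal ((h n s)\<^sup>2)) + z s" for s
  have hm: "(\<lambda>s. ennreal ((h n s)\<^sup>2)) \<in> borel_measurable S" if "n \<in> {1..N}" for n
    using h(1)[OF that] by measurable
  then have sum_m: "(\<lambda>s. \<Sum>n=1..N. ennreal ((h n s)\<^sup>2)) \<in> borel_measurable S"
    by (intro borel_measurable_sum) auto
  then have R: "R \<in> borel_measurable S"
    unfolding R_def using z(1) by (intro borel_measurable_add borel_measurable_times) auto
  have hAE: "AE s in S. \<forall>n\<in>{1..N}. f n s = h n s"
    using h(2) by (intro AE_finite_allI) auto
  have "nn_expectation S Y + ennreal \<alpha> * nn_expectation S (X N)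
      + ennreal \<beta> * (\<Sum>n=1..N. nn_expectation S (X n))
    \<le> (\<integral>\<^sup>+ s. ennreal (Y s) \<partial>S) + (\<integral>\<^sup>+ s. ennreal \<alpha> * ennreal (X N s) \<partial>S)
      + (\<integral>\<^sup>+ s. ennreal \<beta> * (\<Sum>n=1..N. ennreal (X n s)) \<partial>S)"
    by (intro add_mono order_refl nn_integral_cmult_ge
        order_trans[OF mult_left_mono[OF nn_integral_sum_superadditive] nn_integral_cmult_ge]) auto
  also have "\<dots> \<le> (\<integral>\<^sup>+ s. ennreal (Y s) + ennreal \<alpha> * ennreal (X N s)
      + ennreal \<beta> * (\<Sum>n=1..N. ennreal (X n s)) \<partial>S)"
    by (rule order_trans[OF add_right_mono[OF nn_integral_superadditive] nn_integral_superadditive])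
  also have "\<dots> \<le> (\<integral>\<^sup>+ s. R s + ennreal \<gamma> * ennreal (X 0 s) \<partial>S)"
  proof (rule nn_integral_mono_AE)
    show "AE s in S. ennreal (Y s) + ennreal \<alpha> * ennreal (X N s)
        + ennreal \<beta> * (\<Sum>n=1..N. ennreal (X n s)) \<le> R s + ennreal \<gamma> * ennreal (X 0 s)"
      using le hAE z(2)
    proof eventually_elim
      case (elim s)
      have "ennreal (Y s) + ennreal \<alpha> * ennreal (X N s) + ennreal \<beta> * (\<Sum>n=1..N. ennreal (X n s))
        = ennreal (Y s + \<alpha> * X N s + \<beta> * (\<Sum>n=1..N. X n s))"
        using nonneg by (simp add: sum_ennreal ennreal_mult sum_nonneg)
      also have "\<dots> \<le> ennreal (\<gamma> * (\<Sum>n=1..N. (f n s)\<^sup>2) + \<gamma> * X 0 s + Z s)"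
        using elim(1) by (rule ennreal_leI)
      also have "\<dots> = ennreal \<gamma> * (\<Sum>n=1..N. ennreal ((f n s)\<^sup>2)) + ennreal \<gamma> * ennreal (X 0 s) + ennreal (Z s)"
        using nonneg by (simp add: sum_ennreal ennreal_mult sum_nonneg)
      also have "\<dots> = R s + ennreal \<gamma> * ennreal (X 0 s)"
        using elim(2,3) by (simp add: R_def ac_simps)
      finally show ?case .
    qed
  qed
  also have "\<dots> \<le> integral\<^sup>N S R + (\<integral>\<^sup>+ s. ennreal \<gamma> * ennreal (X 0 s) \<partial>S)"
    using R by (rule nn_integral_subadditive)
  also have "(\<integral>\<^sup>+ s. ennreal \<gamma> * ennreal (X 0 s) \<partial>S) = ennreal \<gamma> * nn_expectation S (X 0)"
    by (rule nn_integral_cmult_real) fact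
  also have "integral\<^sup>N S R = (\<integral>\<^sup>+ s. ennreal \<gamma> * (\<Sum>n=1..N. ennreal ((h n s)\<^sup>2)) \<partial>S) + integral\<^sup>N S z"
    unfolding R_def using sum_m z(1) by (intro nn_integral_add) auto
  also have "(\<integral>\<^sup>+ s. ennreal \<gamma> * (\<Sum>n=1..N. ennreal ((h n s)\<^sup>2)) \<partial>S)
      = ennreal \<gamma> * (\<Sum>n=1..N. nn_expectation S (\<lambda>s. (h n s)\<^sup>2))"
    unfolding nn_integral_cmult[OF sum_m] using hm by (subst nn_integral_sum) auto
  also have "(\<Sum>n=1..N. nn_expectation S (\<lambda>s. (h n s)\<^sup>2)) = (\<Sum>n=1..N. nn_expectation S (\<lambda>s. (f n s)\<^sup>2))"
  proof (intro sum.cong refl nn_integral_cong_AE)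
    fix n assume "n \<in> {1..N}"
    from h(2)[OF this] show "AE s in S. ennreal ((h n s)\<^sup>2) = ennreal ((f n s)\<^sup>2)"
      by eventually_elim simp
  qed
  also have "integral\<^sup>N S z = nn_expectation S Z"
    using z(2) by (intro nn_integral_cong_AE) auto
  finally show ?thesis by (simp add: ac_simps)
qed

text \<open>\<open>C\<close> enters only through two inequalities in \<open>\<theta>\<close> and
  \<open>\<theta>p\<close>, so it can be fixed independently of the mesh, the number of samples and
  the time step.\<close>

lemma ensemble_stability:
  fixes D :: "(real^'d) set" and M :: "'w measure" and S :: "'s measure"
    and a :: "'w \<Rightarrow> real^'d \<Rightarrow> real \<Rightarrow> real" and f :: "'w \<Rightarrow> real \<Rightarrow> 'd dual"
  assumes \<theta>: "0 < \<theta>m" "\<theta>p < \<theta>"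
    and M: "prob_space M" and D: "open D" "bounded D"
    and T: "0 < T" "1 \<le> J" "1 \<le> N" "\<Delta>t = T / real N"
    and mesh: "quasi_uniform_mesh \<sigma> D \<T>"
    and W: "independent_samples M S J W"
    and Linf: "AE \<omega> in M. \<forall>n\<in>{1..N}. (\<lambda>x. a \<omega> x (real n * \<Delta>t)) \<in> Linf D"
    and u0: "(\<lambda>(\<omega>, x). u0 \<omega> x) \<in> borel_measurable (M \<Otimes>\<^sub>M lebesgue_on D)"
    and f: "\<And>t. t \<in> {0..T} \<Longrightarrow> strongly_measurable M (Hm1 D) (Hm1_norm D) (\<lambda>\<omega>. f \<omega> t)"
    and ell: "\<And>t. t \<in> {0..T} \<Longrightarrow>
      \<P>(\<omega> in M. \<exists>y. is_arg_min (\<lambda>x. a \<omega> x t) (\<lambda>x. x \<in> closure D) y \<and> \<theta> < a \<omega> y t) = 1"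
    and fluct: "\<And>t i. t \<in> {0..T} \<Longrightarrow> i \<in> {1..J} \<Longrightarrow> AE s in S.
        ereal \<theta>m \<le> Linf_norm D (\<lambda>x. a (W i s) x t - ensemble_mean J (\<lambda>i x. a (W i s) x t) x) \<and>
        Linf_norm D (\<lambda>x. a (W i s) x t - ensemble_mean J (\<lambda>i x. a (W i s) x t) x) \<le> ereal \<theta>p"
    and scheme: "AE s in S. ensemble_scheme D (fe_space D \<T> l) J N \<Delta>t
        (\<lambda>j n x. a (W j s) x (real n * \<Delta>t)) (\<lambda>j n. f (W j s) (real n * \<Delta>t))
        (\<lambda>j. u0 (W j s)) (u s)"
    and j: "j \<in> {1..J}"
    and C: "\<theta>p \<le> C" "1 / (\<theta> - \<theta>p) \<le> C"
  shows "nn_expectation S (\<lambda>s. (L2_norm D (u s j N))\<^sup>2)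
        + ennreal (\<theta>m * \<Delta>t) * nn_expectation S (\<lambda>s. (L2_norm D (grad D (u s j N)))\<^sup>2)
        + ennreal ((\<theta> - \<theta>p) * \<Delta>t) * (\<Sum>n=1..N. nn_expectation S (\<lambda>s. (L2_norm D (grad D (u s j n)))\<^sup>2))
        \<le> ennreal (C * \<Delta>t) * (\<Sum>n=1..N. nn_expectation S (\<lambda>s. (Hm1_norm D (f (W j s) (real n * \<Delta>t)))\<^sup>2))
        + ennreal (C * \<Delta>t) * nn_expectation S (\<lambda>s. (L2_norm D (grad D (u s j 0)))\<^sup>2)
        + nn_expectation S (\<lambda>s. (L2_norm D (u s j 0))\<^sup>2)"
proof (rule nn_expectation_energy)
  have t: "0 < \<Delta>t" using T by simp
  have C0: "0 < C"
    using C(2) \<theta>(2) by (intro less_le_trans[OF _ C(2)]) simp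
  show "0 \<le> \<theta>m * \<Delta>t" "0 \<le> (\<theta> - \<theta>p) * \<Delta>t" "0 < C * \<Delta>t"
    using t \<theta> C0 by simp_all
  have time: "real n * \<Delta>t \<in> {0..T}" if "n \<in> {1..N}" for n
  proof -
    have "real n * T \<le> real N * T" using that T(1) by simp
    then show ?thesis using that T by (simp add: divide_le_eq mult.commute)
  qed
  interpret S: prob_space S using W by (simp add: independent_samples_def)
  note Wj = independent_samples_measurable[OF W j]
  \<comment> \<open>The two-sided fluctuation bound at one time and for one sample suffices: on a
    probability space, a constant statement that holds almost surely is true.\<close>
  have "\<theta>m \<le> \<theta>p"
  proof -
    have "0 \<in> {0..T}" "1 \<in> {1..J}" using T by auto
    from fluct[OF this] have "AE s in S. \<theta>m \<le> \<theta>p"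
    proof eventually_elim
      case (elim s)
      then have "ereal \<theta>m \<le> ereal \<theta>p" by (blast intro: order_trans)
      then show ?case by simp
    qed
    then show ?thesis by (simp only: S.AE_const)
  qed
  show "\<exists>h\<in>borel_measurable S. AE s in S. Hm1_norm D (f (W j s) (real n * \<Delta>t)) = h s"
    if n: "n \<in> {1..N}" for n
  proof -
    obtain h where h: "h \<in> borel_measurable M" "AE \<omega> in M. Hm1_norm D (f \<omega> (real n * \<Delta>t)) = h \<omega>"
      using strongly_measurable_Hm1_norm[OF f[OF time[OF n]] D] by blast
    show ?thesis
      by (rule bexI[where x = "\<lambda>s. h (W j s)"])
        (rule independent_samples_AE[OF W j h(2)], rule measurable_compose[OF Wj h(1)])
  qed
  show "\<exists>h\<in>borel_measurable S. AE s in S. ennreal ((L2_norm D (u s j 0))\<^sup>2) = h s"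
  proof -
    let ?V = "fe_space D \<T> l"
    obtain V0 where V0: "V0 \<subseteq> ?V" "countable V0"
      "\<forall>v\<in>?V. \<forall>e>0. \<exists>w\<in>V0. L2_norm D (\<lambda>x. v x - w x) \<le> e"
      using fe_space_separable[OF D mesh, of l] by (elim exE conjE)
    \<comment> \<open>A countable supremum of functions measurable in the sample, even though
      \<open>u\<close> itself is not assumed measurable.\<close>
    define h where "h s = (SUP v\<in>V0. ennreal (2 * L2_inner D (u0 (W j s)) v - (L2_norm D v)\<^sup>2))" for s
    have "(\<lambda>s. ennreal (2 * L2_inner D (u0 (W j s)) v - (L2_norm D v)\<^sup>2)) \<in> borel_measurable S"
      if "v \<in> V0" for v
    proof -
      have "v \<in> L2 D" using that V0(1) fe_space_subset_L2 by blast
      then have "(\<lambda>\<omega>. L2_inner D (u0 \<omega>) v) \<in> borel_measurable M"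
        using u0 finite_measure_lebesgue_on_bounded[OF D] by (intro borel_measurable_L2_inner)
      from measurable_compose[OF Wj this] show ?thesis
        by (intro measurable_compose[OF _ measurable_ennreal] borel_measurable_diff
            borel_measurable_times borel_measurable_const)
    qed
    then have "h \<in> borel_measurable S"
      unfolding h_def by (intro borel_measurable_SUP V0(2))
    moreover have "AE s in S. ennreal ((L2_norm D (u s j 0))\<^sup>2) = h s"
      using scheme
    proof eventually_elim
      case (elim s)
      show ?case
        unfolding h_def
        by (rule L2_projection_norm_SUP[OF fe_space_subset_L2 V0(1)])
          (use V0(3) elim j in \<open>auto simp: ensemble_scheme_def\<close>)
    qed
    ultimately show ?thesis by blast
  qed
  \<comment> \<open>With finitely many samples and time levels, the almost sure conditions hold
    simultaneously for almost every \<open>s\<close>.\<close>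
  have "AE s in S. \<forall>i\<in>{1..J}. \<forall>n\<in>{1..N}. (\<lambda>x. a (W i s) x (real n * \<Delta>t)) \<in> Linf D"
    by (rule AE_finite_allI[OF finite_atLeastAtMost independent_samples_AE[OF W _ Linf]])
  moreover have "AE s in S. \<forall>i\<in>{1..J}. \<forall>n\<in>{1..N}. \<forall>x\<in>D. \<theta> \<le> a (W i s) x (real n * \<Delta>t)"
  proof (rule AE_finite_allI[OF finite_atLeastAtMost], rule AE_finite_allI[OF finite_atLeastAtMost])
    fix i n assume i: "i \<in> {1..J}" and n: "n \<in> {1..N}"
    have "AE \<omega> in M. \<forall>x\<in>D. \<theta> \<le> a \<omega> x (real n * \<Delta>t)"
      using prob_space.AE_prob_1[OF M ell[OF time[OF n]]]
    proof eventually_elim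
      case (elim \<omega>)
      \<comment> \<open>The minimum over \<open>closure D\<close> is attained at \<open>y\<close>,
        so \<open>\<theta>\<close> bounds the coefficient from below on all of
        \<open>D\<close>.\<close>
      then obtain y where y: "is_arg_min (\<lambda>x. a \<omega> x (real n * \<Delta>t)) (\<lambda>x. x \<in> closure D) y"
        "\<theta> < a \<omega> y (real n * \<Delta>t)" by auto
      have "a \<omega> y (real n * \<Delta>t) \<le> a \<omega> x (real n * \<Delta>t)" if "x \<in> D" for x
        using y(1) closure_subset[of D] that by (auto simp: is_arg_min_linorder)
      then show ?case using y(2) by force
    qed
    then show "AE s in S. \<forall>x\<in>D. \<theta> \<le> a (W i s) x (real n * \<Delta>t)"
      by (rule independent_samples_AE[OF W i])
  qed
  moreover have "AE s in S. \<forall>n\<in>{1..N}. Linf_norm D (\<lambda>x. a (W j s) x (real n * \<Delta>t)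
      - ensemble_mean J (\<lambda>i x. a (W i s) x (real n * \<Delta>t)) x) \<le> ereal \<theta>p"
  proof (intro AE_finite_allI)
    fix n assume "n \<in> {1..N}"
    from fluct[OF time[OF this] j] show "AE s in S. Linf_norm D (\<lambda>x. a (W j s) x (real n * \<Delta>t)
      - ensemble_mean J (\<lambda>i x. a (W i s) x (real n * \<Delta>t)) x) \<le> ereal \<theta>p"
      by eventually_elim blast
  qed auto
  moreover have "AE s in S. \<forall>n\<in>{1..N}. f (W j s) (real n * \<Delta>t) \<in> Hm1 D"
  proof (intro AE_finite_allI)
    fix n assume n: "n \<in> {1..N}"
    have "AE \<omega> in M. f \<omega> (real n * \<Delta>t) \<in> Hm1 D"
      using f[OF time[OF n]] by (simp add: strongly_measurable_def)
    then show "AE s in S. f (W j s) (real n * \<Delta>t) \<in> Hm1 D"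
      by (rule independent_samples_AE[OF W j])
  qed auto
  ultimately show "AE s in S. (L2_norm D (u s j N))\<^sup>2 + \<theta>m * \<Delta>t * (L2_norm D (grad D (u s j N)))\<^sup>2
      + (\<theta> - \<theta>p) * \<Delta>t * (\<Sum>n=1..N. (L2_norm D (grad D (u s j n)))\<^sup>2)
    \<le> C * \<Delta>t * (\<Sum>n=1..N. (Hm1_norm D (f (W j s) (real n * \<Delta>t)))\<^sup>2)
      + C * \<Delta>t * (L2_norm D (grad D (u s j 0)))\<^sup>2 + (L2_norm D (u s j 0))\<^sup>2"
    using scheme
  proof eventually_elim
    case (elim s)
    let ?X = "\<lambda>n. (L2_norm D (grad D (u s j n)))\<^sup>2"
    let ?f = "\<Sum>n=1..N. (Hm1_norm D (f (W j s) (real n * \<Delta>t)))\<^sup>2"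
    have "(L2_norm D (u s j N))\<^sup>2 + \<Delta>t * \<theta>p * ?X N + \<Delta>t * (\<theta> - \<theta>p) * (\<Sum>n=1..N. ?X n)
      \<le> (L2_norm D (u s j 0))\<^sup>2 + \<Delta>t * \<theta>p * ?X 0 + \<Delta>t / (\<theta> - \<theta>p) * ?f"
      by (rule ensemble_scheme_energy[OF D T(2) j t \<theta>(2) _ _ _ _ _ elim(5)])
        (use elim(1-4) in \<open>auto simp: fe_space_def\<close>)
    \<comment> \<open>The final gradient term carries the larger weight \<open>\<theta>p\<close>;
      the claim needs it only with \<open>\<theta>m\<close>.\<close>
    moreover have "\<theta>m * \<Delta>t * ?X N \<le> \<Delta>t * \<theta>p * ?X N"
      using \<open>\<theta>m \<le> \<theta>p\<close> t by (intro mult_right_mono) auto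
    moreover have "\<Delta>t * \<theta>p * ?X 0 \<le> C * \<Delta>t * ?X 0"
      using C(1) t by (intro mult_right_mono) auto
    moreover have "\<Delta>t / (\<theta> - \<theta>p) * ?f \<le> C * \<Delta>t * ?f"
      using mult_right_mono[OF C(2), of \<Delta>t] t by (intro mult_right_mono sum_nonneg) auto
    ultimately show ?case by (simp add: mult.commute mult.left_commute)
  qed
qed (rule zero_le_power2)+

theorem theorem4p1:
  fixes \<theta> \<theta>m \<theta>p :: real
  assumes "CARD('d::finite) \<in> {1, 2, 3}"
    and "0 < \<theta>" and "0 < \<theta>m" and "0 < \<theta>p" and "\<theta>p < \<theta>"
  shows "\<exists>C>0. \<forall>(M :: 'w measure) (S :: 's measure) (W :: nat \<Rightarrow> 's \<Rightarrow> 'w)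
      (D :: (real^'d) set) (T :: real) (l :: nat) (J :: nat) (N :: nat) (\<Delta>t :: real)
      (\<sigma> :: real) (\<T> :: (real^'d) set set)
      (a :: 'w \<Rightarrow> real^'d \<Rightarrow> real \<Rightarrow> real) (f :: 'w \<Rightarrow> real \<Rightarrow> 'd dual) (u0 :: 'w \<Rightarrow> real^'d \<Rightarrow> real)
      (u :: 's \<Rightarrow> nat \<Rightarrow> nat \<Rightarrow> real^'d \<Rightarrow> real).
    prob_space M \<longrightarrow> complete_measure M \<longrightarrow>
    bounded_lipschitz_domain D \<longrightarrow> 0 < T \<longrightarrow> 1 \<le> l \<longrightarrow> 1 \<le> J \<longrightarrow> 1 \<le> N \<longrightarrow> \<Delta>t = T / real N \<longrightarrow>
    quasi_uniform_mesh \<sigma> D \<T> \<longrightarrow>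
    independent_samples M S J W \<longrightarrow>
    random_field M (D \<times> {0..T}) (\<lambda>\<omega> (x, t). a \<omega> x t) \<longrightarrow>
    (\<forall>t\<in>{0..T}. (\<lambda>(\<omega>, x). a \<omega> x t) \<in> borel_measurable (M \<Otimes>\<^sub>M lebesgue_on D)) \<longrightarrow>
    (AE \<omega> in M. \<forall>n\<in>{1..N}. (\<lambda>x. a \<omega> x (real n * \<Delta>t)) \<in> Linf D) \<longrightarrow>
    random_field M D u0 \<longrightarrow>
    (\<lambda>(\<omega>, x). u0 \<omega> x) \<in> borel_measurable (M \<Otimes>\<^sub>M lebesgue_on D) \<longrightarrow>
    (AE \<omega> in M. u0 \<omega> \<in> L2 D) \<longrightarrow>
    Hm1_random_field M D T f \<longrightarrow>
    f \<in> bochner_L2 M (L2_time_Hm1 T D) (L2_time_Hm1_norm T D) \<longrightarrow>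
    (\<forall>t\<in>{0..T}. \<P>(\<omega> in M. \<exists>y. is_arg_min (\<lambda>x. a \<omega> x t) (\<lambda>x. x \<in> closure D) y \<and> \<theta> < a \<omega> y t) = 1) \<longrightarrow>
    (\<forall>t\<in>{0..T}. \<forall>j\<in>{1..J}. AE s in S.
        ereal \<theta>m \<le> Linf_norm D (\<lambda>x. a (W j s) x t - ensemble_mean J (\<lambda>i x. a (W i s) x t) x) \<and>
        Linf_norm D (\<lambda>x. a (W j s) x t - ensemble_mean J (\<lambda>i x. a (W i s) x t) x) \<le> ereal \<theta>p) \<longrightarrow>
    (AE s in S. ensemble_scheme D (fe_space D \<T> l) J N \<Delta>t
        (\<lambda>j n x. a (W j s) x (real n * \<Delta>t)) (\<lambda>j n. f (W j s) (real n * \<Delta>t))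
        (\<lambda>j. u0 (W j s)) (u s)) \<longrightarrow>
    (\<forall>j\<in>{1..J}.
        nn_expectation S (\<lambda>s. (L2_norm D (u s j N))\<^sup>2)
        + ennreal (\<theta>m * \<Delta>t) * nn_expectation S (\<lambda>s. (L2_norm D (grad D (u s j N)))\<^sup>2)
        + ennreal ((\<theta> - \<theta>p) * \<Delta>t) * (\<Sum>n=1..N. nn_expectation S (\<lambda>s. (L2_norm D (grad D (u s j n)))\<^sup>2))
        \<le> ennreal (C * \<Delta>t) * (\<Sum>n=1..N. nn_expectation S (\<lambda>s. (Hm1_norm D (f (W j s) (real n * \<Delta>t)))\<^sup>2))
        + ennreal (C * \<Delta>t) * nn_expectation S (\<lambda>s. (L2_norm D (grad D (u s j 0)))\<^sup>2)
        + nn_expectation S (\<lambda>s. (L2_norm D (u s j 0))\<^sup>2))"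
  \<comment> \<open>The witness is supplied before the mesh, \<open>J\<close> and the time step are
    introduced, which expresses the required independence.\<close>
  apply (intro exI[of _ "max \<theta>p (1 / (\<theta> - \<theta>p))"] conjI allI impI ballI)
  subgoal using assms(4) by simp
  subgoal premises prems for M S W D T l J N \<Delta>t \<sigma> \<T> a f u0 u j
  proof -
    have D: "open D" "bounded D"
      using prems(3) by (auto simp: bounded_lipschitz_domain_def)
    have f: "strongly_measurable M (Hm1 D) (Hm1_norm D) (\<lambda>\<omega>. f \<omega> t)" if "t \<in> {0..T}" for t
      using prems(17) that unfolding Hm1_random_field_def by blast
    show ?thesis
      by (rule ensemble_stability[where a = a, OF assms(3,5) prems(1) D prems(4,6-10,13,15) f
            prems(19,20)[rule_format] prems(21,22)]) simp_all
  qed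
  done

end
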